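(* Let $b$ be a finite Blaschke product, let $\{v_i\}_{i=1}^N$ be an orthonormal basis of $\mathcal{D}=H^2(\mathbb{T})\ominus\pi(b)H^2(\mathbb{T})$, and let $m_i=v_iJ^{-1/2}$ (an orthonormal basis of $L^\infty(\mathbb{T})_{\mathcal{L}}$). Then a function $f\in L^\infty(\mathbb{T})$ lies in $H^\infty(\mathbb{T})$ if and only if $\langle m_i,f\rangle=\mathcal{L}(\overline{m_i}f)$ lies in $H^\infty(\mathbb{T})$ for all $i$. Further, $f$ lies in the disc algebra $A(\mathbb{D})$ if and only if $\langle m_i,f\rangle$ lies in $A(\mathbb{D})$ for all $i$.
   Context: $b=\prod_{j=1}^N b_{\alpha_j}$ is a finite Blaschke product with $N$ zeros in $\mathbb{D}$ ($b_w(z)=\frac{|w|}{w}\frac{w-z}{1-\overline{w}z}$, $b_0(z)=z$); $\beta(\varphi)=\varphi\circ b$. $\pi(\varphi)$ is multiplication by $\varphi$ on $L^2(\mathbb{T})$. $J$ is the outer function with $J(0)>0$ and $|J|=J_0$ on $\mathbb{T}$ where $J_0(z)=\frac{zb'(z)}{Nb(z)}$; $J^{-1/2}$ is the reciprocal of its outer square root. The transfer operator is $\mathcal{L}(\xi)(z)=\frac1N\sum_{b(w)=z}\xi(w)$. $L^\infty(\mathbb{T})_{\mathcal{L}}$ is $L^\infty(\mathbb{T})$ viewed as a Hilbert $C^*$-module over $L^\infty(\mathbb{T})$ with right action $\xi\cdot a=\xi\beta(a)$ and inner product $\langle\xi,\eta\rangle=\mathcal{L}(\overline\xi\eta)$.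 $A(\mathbb{D})$ is identified with $C(\mathbb{T})\cap H^\infty(\mathbb{T})$. *)

theory Defs
  imports "HOL-Analysis.Analysis"
begin

text \<open>Functions on the unit circle T are modelled as complex-valued functions on complex
  numbers, of which only the values on the unit circle matter. The (normalised) measure on
  T is the push-forward of Lebesgue measure on [0, 2 pi] under t maps to cis t.\<close>

definition circM :: "real measure" where
  "circM = lebesgue_on {0..2*pi}"

definition on_circ :: "(complex \<Rightarrow> complex) \<Rightarrow> real \<Rightarrow> complex" where
  "on_circ f = (\<lambda>t. f (cis t))"

definition ae_eq_T :: "(complex \<Rightarrow> complex) \<Rightarrow> (complex \<Rightarrow> complex) \<Rightarrow> bool" where
  "ae_eq_T f g \<longleftrightarrow> (AE t in circM. f (cis t) = g (cis t))"

definition Linf_T :: "(complex \<Rightarrow> complex) \<Rightarrow> bool" where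
  "Linf_T f \<longleftrightarrow> on_circ f \<in> borel_measurable circM \<and>
     (\<exists>C. AE t in circM. cmod (f (cis t)) \<le> C)"

definition L2_T :: "(complex \<Rightarrow> complex) \<Rightarrow> bool" where
  "L2_T f \<longleftrightarrow> on_circ f \<in> borel_measurable circM \<and>
     integrable circM (\<lambda>t. (cmod (f (cis t)))\<^sup>2)"

definition fourier_coeff :: "(complex \<Rightarrow> complex) \<Rightarrow> int \<Rightarrow> complex" where
  "fourier_coeff f n = (LINT t|circM. f (cis t) * cis (- (of_int n * t))) / of_real (2*pi)"

definition inner_L2 :: "(complex \<Rightarrow> complex) \<Rightarrow> (complex \<Rightarrow> complex) \<Rightarrow> complex" where
  "inner_L2 f g = (LINT t|circM. cnj (f (cis t)) * g (cis t)) / of_real (2*pi)"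

definition Hinf_T :: "(complex \<Rightarrow> complex) \<Rightarrow> bool" where
  "Hinf_T f \<longleftrightarrow> Linf_T f \<and> (\<forall>n<0. fourier_coeff f n = 0)"

definition H2_T :: "(complex \<Rightarrow> complex) \<Rightarrow> bool" where
  "H2_T f \<longleftrightarrow> L2_T f \<and> (\<forall>n<0. fourier_coeff f n = 0)"

text \<open>Disc algebra A(D), identified with C(T) \<inter> H^infinity(T): an L^infinity class that has a
  continuous representative on T and lies in H^infinity.\<close>
definition disc_alg_T :: "(complex \<Rightarrow> complex) \<Rightarrow> bool" where
  "disc_alg_T f \<longleftrightarrow> Hinf_T f \<and> (\<exists>g. continuous_on (sphere 0 1) g \<and> ae_eq_T f g)"

definition blaschke_factor :: "complex \<Rightarrow> complex \<Rightarrow> complex" where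
  "blaschke_factor w z = (if w = 0 then z
      else (of_real (cmod w) / w) * ((w - z) / (1 - cnj w * z)))"

definition blaschke :: "nat \<Rightarrow> (nat \<Rightarrow> complex) \<Rightarrow> complex \<Rightarrow> complex" where
  "blaschke N \<alpha> z = (\<Prod>j<N. blaschke_factor (\<alpha> j) z)"

definition model_space :: "(complex \<Rightarrow> complex) \<Rightarrow> (complex \<Rightarrow> complex) set" where
  "model_space b = {h. H2_T h \<and> (\<forall>g. H2_T g \<longrightarrow> inner_L2 (\<lambda>z. b z * g z) h = 0)}"

definition onb_of :: "(complex \<Rightarrow> complex) set \<Rightarrow> nat \<Rightarrow> (nat \<Rightarrow> complex \<Rightarrow> complex) \<Rightarrow> bool" where
  "onb_of S N v \<longleftrightarrow> (\<forall>i<N. v i \<in> S) \<and>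
     (\<forall>i<N. \<forall>j<N. inner_L2 (v i) (v j) = (if i = j then 1 else 0)) \<and>
     (\<forall>h\<in>S. ae_eq_T h (\<lambda>z. \<Sum>i<N. inner_L2 (v i) h * v i z))"

definition J0 :: "nat \<Rightarrow> (complex \<Rightarrow> complex) \<Rightarrow> complex \<Rightarrow> complex" where
  "J0 N b z = z * deriv b z / (of_nat N * b z)"

text \<open>Outer function on the disc with boundary log-modulus u (Herglotz formula); it is
  automatically positive at 0.\<close>
definition outer_fun :: "(complex \<Rightarrow> real) \<Rightarrow> complex \<Rightarrow> complex" where
  "outer_fun u z = exp ((LINT t|circM. ((cis t + z) / (cis t - z)) * of_real (u (cis t)))
                         / of_real (2*pi))"

definition boundary_val :: "(complex \<Rightarrow> complex) \<Rightarrow> complex \<Rightarrow> complex" where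
  "boundary_val F z = Lim (at_left 1) (\<lambda>r::real. F (of_real r * z))"

text \<open>J is the outer function with |J| = J_0 on T and J(0) > 0; its outer square root is the
  outer function with log-modulus (1/2) log J_0; J^{-1/2} is the reciprocal of the latter
  (as a function on T).\<close>
definition J_outer :: "nat \<Rightarrow> (complex \<Rightarrow> complex) \<Rightarrow> complex \<Rightarrow> complex" where
  "J_outer N b = outer_fun (\<lambda>z. ln (cmod (J0 N b z)))"

definition J_sqrt :: "nat \<Rightarrow> (complex \<Rightarrow> complex) \<Rightarrow> complex \<Rightarrow> complex" where
  "J_sqrt N b = outer_fun (\<lambda>z. ln (cmod (J0 N b z)) / 2)"

definition J_inv_sqrt :: "nat \<Rightarrow> (complex \<Rightarrow> complex) \<Rightarrow> complex \<Rightarrow> complex" where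
  "J_inv_sqrt N b z = inverse (boundary_val (J_sqrt N b) z)"

definition transfer :: "nat \<Rightarrow> (complex \<Rightarrow> complex) \<Rightarrow> (complex \<Rightarrow> complex) \<Rightarrow> complex \<Rightarrow> complex" where
  "transfer N b \<xi> z = (\<Sum>w\<in>{w. cmod w = 1 \<and> b w = z}. \<xi> w) / of_nat N"

definition inner_L :: "nat \<Rightarrow> (complex \<Rightarrow> complex) \<Rightarrow> (complex \<Rightarrow> complex) \<Rightarrow> (complex \<Rightarrow> complex) \<Rightarrow> complex \<Rightarrow> complex" where
  "inner_L N b \<xi> \<eta> = transfer N b (\<lambda>w. cnj (\<xi> w) * \<eta> w)"

end

theory Submission
  imports Defs "HOL-Complex_Analysis.Complex_Analysis"
begin

text \<open>
  Write \<open>E = exp h\<close> for the outer square root of \<open>J\<close>. The change of variables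
  \<open>\<integral> L(\<xi>) = \<integral> \<xi> J\<^sub>0\<close> and \<open>J\<^sub>0 = |E|\<^sup>2\<close> on the circle show that the \<open>n\<close>-th Fourier coefficient of
  \<open>\<langle>m\<^sub>i, f\<rangle>\<close> is the inner product of \<open>b\<^sup>n v\<^sub>i\<close> with \<open>E f\<close>. Since the spaces \<open>b\<^sup>n D\<close> with \<open>n < 0\<close> span the
  complement of \<open>H\<^sup>2\<close>, the negative coefficients of all \<open>\<langle>m\<^sub>i, f\<rangle>\<close> vanish iff \<open>E f\<close>, equivalently \<open>f\<close>,
  is analytic. Since the spaces \<open>b\<^sup>n D\<close> over all integers \<open>n\<close> span \<open>L\<^sup>2\<close>, the same formula
  gives the expansion \<open>f = \<Sum>\<^sub>i m\<^sub>i \<langle>m\<^sub>i, f\<rangle> \<circ> b\<close>; elements of \<open>D\<close> are rational functions without poles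
  on the circle, so the \<open>m\<^sub>i\<close> are continuous and continuity passes between \<open>f\<close> and its coefficients.
\<close>

section \<open>Integrable functions on the circle and their Fourier coefficients\<close>

text \<open>The obstacle is that functions are pointwise representatives while the claim concerns
  classes modulo null sets: \<open>transfer\<close> adds values along fibres, and
  \<open>J_inv_sqrt\<close> takes a radial limit at each point. The limit is harmless because J_0
  has neither zeros nor poles on the circle: its logarithm is there the real part of a function
  analytic on the closed disc, so E is continuous and zero-free up to the boundary. The fibre sums
  respect null sets by the mean formula applied to |f|. Both spanning claims rest on one estimate:
  since |b| < 1 inside the disc, each fixed Taylor coefficient of b^k tends to 0 as k grows.
  Spanning is expressed by annihilation: a bounded function whose pairings with the given functions
  vanish is analytic, or zero almost everywhere. Multipliers analytic on the closed disc act on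
  Fourier coefficients by an absolutely convergent Cauchy product.\<close>

definition L1_T :: "(complex \<Rightarrow> complex) \<Rightarrow> bool" where
  "L1_T f \<longleftrightarrow> integrable circM (on_circ f)"

lemma space_circM [simp]: "space circM = {0..2*pi}"
  by (simp add: circM_def)

lemma finite_measure_circM: "finite_measure circM"
  unfolding circM_def by (intro finite_measure_lebesgue_on) auto

lemma measurable_circM_continuous:
  fixes h :: "real \<Rightarrow> 'a::{euclidean_space}"
  assumes "continuous_on {0..2*pi} h"
  shows "h \<in> borel_measurable circM"
  unfolding circM_def using assms by (intro continuous_imp_measurable_on_sets_lebesgue) auto

lemma continuous_on_circ:
  assumes "continuous_on (sphere 0 1) f"
  shows "continuous_on A (\<lambda>t. f (cis t))"
  by (rule continuous_on_compose2[OF assms]) (auto intro: continuous_intros)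

lemma continuous_circ_bounded:
  assumes "continuous_on (sphere 0 1) (f :: complex \<Rightarrow> complex)"
  obtains C where "C > 0" "\<And>z. cmod z = 1 \<Longrightarrow> cmod (f z) \<le> C"
proof -
  have "bounded (f ` sphere 0 1)"
    using assms compact_continuous_image compact_imp_bounded compact_sphere by blast
  then obtain C where "C > 0" "\<forall>x\<in>f ` sphere 0 1. cmod x \<le> C"
    using bounded_pos by blast
  then show ?thesis by (intro that[of C]) auto
qed

section \<open>Products and almost-everywhere changes of L^1, L^2 and L^infinity functions\<close>

lemma L1_T_mult:
  assumes "L1_T g" and meas: "on_circ f \<in> borel_measurable circM"
    and bdd: "AE t in circM. cmod (f (cis t)) \<le> C"
  shows "L1_T (\<lambda>z. f z * g z)"
  unfolding L1_T_def on_circ_def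
proof (rule Bochner_Integration.integrable_bound)
  show "integrable circM (\<lambda>t. C * cmod (g (cis t)))"
    using assms(1) by (auto simp: L1_T_def on_circ_def)
  show "(\<lambda>t. f (cis t) * g (cis t)) \<in> borel_measurable circM"
    using meas assms(1) by (auto simp: L1_T_def on_circ_def)
  show "AE t in circM. norm (f (cis t) * g (cis t)) \<le> norm (C * cmod (g (cis t)))"
    using bdd
  proof eventually_elim
    case (elim t)
    then have "C \<ge> 0" using norm_ge_zero order_trans by blast
    then show ?case using elim by (simp add: norm_mult mult_right_mono)
  qed
qed

lemma L1_T_Linf_mult: "Linf_T f \<Longrightarrow> L1_T g \<Longrightarrow> L1_T (\<lambda>z. f z * g z)"
  using L1_T_mult unfolding Linf_T_def by blast

lemma Linf_T_continuous: 
  assumes "continuous_on (sphere 0 1) f" shows "Linf_T f"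
proof -
  obtain C where "C > 0" "\<And>z. cmod z = 1 \<Longrightarrow> cmod (f z) \<le> C"
    using continuous_circ_bounded[OF assms] by blast
  then show ?thesis unfolding Linf_T_def on_circ_def
    using measurable_circM_continuous[OF continuous_on_circ[OF assms]] by (auto intro!: exI[of _ C])
qed

lemma Linf_T_mult: 
  assumes "Linf_T f" "Linf_T g" shows "Linf_T (\<lambda>z. f z * g z)"
proof -
  obtain C D where "AE t in circM. cmod (f (cis t)) \<le> C" "AE t in circM. cmod (g (cis t)) \<le> D"
    using assms by (auto simp: Linf_T_def)
  then have "AE t in circM. cmod (f (cis t) * g (cis t)) \<le> C * D"
  proof eventually_elim
    case (elim t)
    then show ?case unfolding norm_mult by (intro mult_mono) (auto intro: order_trans[OF norm_ge_zero])
  qed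
  then show ?thesis using assms by (auto simp: Linf_T_def on_circ_def)
qed

lemma measurable_cnj: "f \<in> borel_measurable M \<Longrightarrow> (\<lambda>t. cnj (f t)) \<in> borel_measurable M"
  by (rule borel_measurable_continuous_on[where f=cnj]) (auto intro: continuous_intros)

lemma Linf_T_cnj: "Linf_T f \<Longrightarrow> Linf_T (\<lambda>z. cnj (f z))"
  by (auto simp: Linf_T_def on_circ_def intro: measurable_cnj)

lemma Linf_T_L1: "Linf_T f \<Longrightarrow> L1_T f"
  using L1_T_Linf_mult[of f "\<lambda>_. 1"] finite_measure.integrable_const[OF finite_measure_circM, of "1::complex"]
  by (simp add: L1_T_def on_circ_def)

lemma L1_T_continuous: "continuous_on (sphere 0 1) f \<Longrightarrow> L1_T f"
  by (simp add: Linf_T_L1 Linf_T_continuous)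

lemma L1_T_continuous_mult: 
  "continuous_on (sphere 0 1) f \<Longrightarrow> L1_T g \<Longrightarrow> L1_T (\<lambda>z. f z * g z)"
  by (simp add: L1_T_Linf_mult Linf_T_continuous)

lemma L1_T_add: "L1_T f \<Longrightarrow> L1_T g \<Longrightarrow> L1_T (\<lambda>z. f z + g z)"
  and L1_T_diff: "L1_T f \<Longrightarrow> L1_T g \<Longrightarrow> L1_T (\<lambda>z. f z - g z)"
  and L1_T_cmult: "L1_T f \<Longrightarrow> L1_T (\<lambda>z. c * f z)"
  and L1_T_cnj: "L1_T f \<Longrightarrow> L1_T (\<lambda>z. cnj (f z))"
  by (simp_all add: L1_T_def on_circ_def)

lemma L1_T_L2_L2:
  assumes "L2_T f" "L2_T g" shows "L1_T (\<lambda>z. f z * g z)"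
  unfolding L1_T_def on_circ_def
proof (rule Bochner_Integration.integrable_bound)
  show "integrable circM (\<lambda>t. (cmod (f (cis t)))\<^sup>2 + (cmod (g (cis t)))\<^sup>2)"
    using assms by (auto simp: L2_T_def)
  show "(\<lambda>t. f (cis t) * g (cis t)) \<in> borel_measurable circM"
    using assms by (auto simp: L2_T_def on_circ_def)
  have "x * y \<le> x\<^sup>2 + y\<^sup>2" if "x \<ge> 0" "y \<ge> 0" for x y :: real
    using mult_nonneg_nonneg[OF that] sum_squares_bound[of x y] by linarith
  then show "AE t in circM. norm (f (cis t) * g (cis t)) \<le> norm ((cmod (f (cis t)))\<^sup>2 + (cmod (g (cis t)))\<^sup>2)"
    by (simp add: norm_mult)
qed

lemma L2_T_cnj: "L2_T f \<Longrightarrow> L2_T (\<lambda>z. cnj (f z))"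
  by (auto simp: L2_T_def on_circ_def intro: measurable_cnj)

lemma Linf_T_L2: 
  assumes "Linf_T f" shows "L2_T f"
proof -
  have "L1_T (\<lambda>z. f z * cnj (f z))" 
    using assms Linf_T_cnj Linf_T_mult Linf_T_L1 by blast
  then have "integrable circM (\<lambda>t. norm (f (cis t) * cnj (f (cis t))))"
    by (simp add: L1_T_def on_circ_def integrable_norm)
  then show ?thesis using assms by (simp add: L2_T_def Linf_T_def norm_mult power2_eq_square)
qed

lemma L2_T_L1: "L2_T f \<Longrightarrow> L1_T f"
  using L1_T_L2_L2[of f "\<lambda>_. 1"] Linf_T_L2[OF Linf_T_continuous[of "\<lambda>_. 1"]] by simp

lemma L2_T_Linf_mult:
  assumes "Linf_T f" "L2_T g" shows "L2_T (\<lambda>z. f z * g z)"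
proof -
  \<comment> \<open>This product is |f g|^2 on the circle, grouped as a bounded factor times an
    integrable one.\<close>
  have 1: "L1_T (\<lambda>z. f z * cnj (f z) * (g z * cnj (g z)))"
    by (intro L1_T_Linf_mult Linf_T_mult L1_T_L2_L2 assms L2_T_cnj Linf_T_cnj)
  have "integrable circM (\<lambda>t. norm (f (cis t) * cnj (f (cis t)) * (g (cis t) * cnj (g (cis t)))))"
    using 1 unfolding L1_T_def on_circ_def by (rule integrable_norm)
  moreover have "(\<lambda>t. f (cis t) * g (cis t)) \<in> borel_measurable circM"
    using assms by (intro borel_measurable_times) (auto simp: L2_T_def Linf_T_def on_circ_def)
  ultimately show ?thesis
    by (simp add: L2_T_def norm_mult power2_eq_square on_circ_def mult_ac)
qed

section \<open>The mean over the circle and Fourier coefficients\<close>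

lemma cis_neg_mult: "cis (- (of_int n * t)) = cis t powi (-n)"
  by (simp add: cis_power_int)

lemma continuous_on_powi_circ: "continuous_on (sphere 0 1) (\<lambda>z::complex. z powi n)"
  by (intro continuous_intros) auto

definition mean_T :: "(complex \<Rightarrow> complex) \<Rightarrow> complex" where
  "mean_T f = (LINT t|circM. f (cis t)) / of_real (2*pi)"

lemma fourier_coeff_mean: "fourier_coeff f n = mean_T (\<lambda>z. f z * z powi (-n))"
  by (simp add: fourier_coeff_def mean_T_def cis_neg_mult)

lemma inner_L2_mean: "inner_L2 f g = mean_T (\<lambda>z. cnj (f z) * g z)"
  by (simp add: inner_L2_def mean_T_def)

lemma mean_T_add: "L1_T f \<Longrightarrow> L1_T g \<Longrightarrow> mean_T (\<lambda>z. f z + g z) = mean_T f + mean_T g"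
  by (simp add: mean_T_def L1_T_def on_circ_def add_divide_distrib)

lemma mean_T_diff: "L1_T f \<Longrightarrow> L1_T g \<Longrightarrow> mean_T (\<lambda>z. f z - g z) = mean_T f - mean_T g"
  by (simp add: mean_T_def L1_T_def on_circ_def diff_divide_distrib)

lemma mean_T_cmult: "mean_T (\<lambda>z. c * f z) = c * mean_T f"
  by (simp add: mean_T_def)

lemma mean_T_cnj: "mean_T (\<lambda>z. cnj (f z)) = cnj (mean_T f)"
  by (simp add: mean_T_def)

lemma mean_T_sum: "(\<And>i. i \<in> I \<Longrightarrow> L1_T (f i)) \<Longrightarrow> mean_T (\<lambda>z. \<Sum>i\<in>I. f i z) = (\<Sum>i\<in>I. mean_T (f i))"
  unfolding mean_T_def L1_T_def on_circ_def by (subst Bochner_Integration.integral_sum) (auto simp: sum_divide_distrib)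

lemma mean_T_cong: "(\<And>z. cmod z = 1 \<Longrightarrow> f z = g z) \<Longrightarrow> mean_T f = mean_T g"
  by (simp add: mean_T_def)

lemma L1_T_cong: "(\<And>z. cmod z = 1 \<Longrightarrow> f z = g z) \<Longrightarrow> L1_T f = L1_T g"
  unfolding L1_T_def on_circ_def by (intro Bochner_Integration.integrable_cong) auto

lemma ae_eq_T_sym: "ae_eq_T f g \<Longrightarrow> ae_eq_T g f"
  unfolding ae_eq_T_def by (auto elim: eventually_mono)

text \<open>Completeness of Lebesgue measure is the reason. Both functions are extended by 0 to the
  whole line, where almost-everywhere equality preserves measurability, and then restricted
  again.\<close>

lemma measurable_ae_circM:
  assumes "on_circ f \<in> borel_measurable circM" "ae_eq_T f g"
  shows "on_circ g \<in> borel_measurable circM"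
proof -
  define S where "S = {0..2*pi}"
  have S: "S \<in> sets lebesgue" and S': "S \<inter> space lebesgue \<in> sets lebesgue" by (auto simp: S_def)
  define F G where "F = (\<lambda>t. if t \<in> S then on_circ f t else 0)" "G = (\<lambda>t. if t \<in> S then on_circ g t else 0)"
  have M: "circM = lebesgue_on S" by (simp add: circM_def S_def)
  have F: "F \<in> borel_measurable lebesgue"
    unfolding F_G_def by (rule borel_measurable_if_I[OF _ S]) (use assms(1) M in simp)
  have "AE t in lebesgue_on S. on_circ f t = on_circ g t"
    using assms(2) unfolding ae_eq_T_def on_circ_def M .
  from iffD1[OF AE_restrict_space_iff[OF S'] this]
  have "AE t in lebesgue. F t = G t"
    unfolding F_G_def by (rule eventually_mono) auto
  with F have "G \<in> borel_measurable lebesgue"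
    using borel_measurable_AE by blast
  then show ?thesis
    unfolding F_G_def M by (rule borel_measurable_if_D)
qed

lemma mean_T_ae:
  assumes "ae_eq_T f g" "on_circ f \<in> borel_measurable circM"
  shows "mean_T f = mean_T g"
proof -
  have "integral\<^sup>L circM (on_circ f) = integral\<^sup>L circM (on_circ g)"
    by (rule integral_cong_AE[OF assms(2) measurable_ae_circM[OF assms(2,1)]])
       (use assms(1) in \<open>simp add: ae_eq_T_def on_circ_def\<close>)
  then show ?thesis by (simp add: mean_T_def on_circ_def)
qed

lemma L1_T_ae:
  assumes "ae_eq_T f g" "L1_T f" shows "L1_T g"
proof -
  have f: "integrable circM (on_circ f)" using assms(2) by (simp add: L1_T_def)
  have "integrable circM (on_circ g)"
    by (rule Bochner_Integration.integrable_cong_AE_imp[OF f measurable_ae_circM[OF _ assms(1)]])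
       (use f assms(1) in \<open>simp_all add: ae_eq_T_def on_circ_def\<close>)
  then show ?thesis by (simp add: L1_T_def)
qed

lemma Linf_T_ae_eq:
  assumes "ae_eq_T f g" "Linf_T f" shows "Linf_T g"
proof -
  have m: "on_circ f \<in> borel_measurable circM" using assms by (auto simp: Linf_T_def)
  obtain C where "AE t in circM. cmod (f (cis t)) \<le> C" using assms by (auto simp: Linf_T_def)
  with assms(1) have "AE t in circM. cmod (g (cis t)) \<le> C"
    unfolding ae_eq_T_def by eventually_elim auto
  then show ?thesis using measurable_ae_circM[OF m assms(1)] by (auto simp: Linf_T_def)
qed

lemma mean_T_powi: "mean_T (\<lambda>z. z powi n) = (if n = 0 then 1 else 0)"
proof -
  have int: "integrable circM (\<lambda>t. cis t powi n)"
    using L1_T_continuous[OF continuous_on_powi_circ] by (simp add: L1_T_def on_circ_def)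
  have "(LINT t|circM. cis t powi n) = integral {0..2*pi} (\<lambda>t. cis t powi n)"
    using int unfolding circM_def by (intro lebesgue_integral_eq_integral) auto
  also have "\<dots> = (if n = 0 then 2 * pi else 0)"
  proof (cases "n = 0")
    case False
    let ?F = "\<lambda>t. cis (of_int n * t) / (\<i> * of_int n)"
    have "((\<lambda>t. cis (of_int n * t)) has_integral (?F (2*pi) - ?F 0)) {0..2*pi}"
    proof (rule fundamental_theorem_of_calculus)
      fix x :: real
      show "(?F has_vector_derivative cis (of_int n * x)) (at x within {0..2*pi})"
      proof -
        have "((\<lambda>z. exp (\<i> * of_int n * z) / (\<i> * of_int n)) has_field_derivative 
                exp (\<i> * of_int n * of_real x)) (at (of_real x))"
          using False by (auto intro!: derivative_eq_intros)
        from has_vector_derivative_real_field[OF this] show ?thesis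
          by (simp add: cis_conv_exp mult.assoc)
      qed
    qed auto
    moreover have "?F (2*pi) - ?F 0 = 0"
      using cis_multiple_2pi[of "of_int n"] by (simp add: mult.commute)
    ultimately show ?thesis using False by (simp add: cis_power_int integral_unique)
  qed (simp add: scaleR_conv_of_real)
  finally show ?thesis by (simp add: mean_T_def)
qed

lemma fourier_coeff_powi_mult: "fourier_coeff (\<lambda>z. z powi k * g z) n = fourier_coeff g (n - k)"
  unfolding fourier_coeff_mean
proof (rule mean_T_cong)
  fix z :: complex assume "cmod z = 1"
  then have "z \<noteq> 0" by auto
  then show "z powi k * g z * z powi - n = g z * z powi - (n - k)"
    by (simp add: power_int_diff power_int_minus field_simps)
qed

lemma fourier_coeff_powi: "fourier_coeff (\<lambda>z. z powi k) n = (if n = k then 1 else 0)"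
  using fourier_coeff_powi_mult[of k "\<lambda>_. 1" n] mean_T_powi[of "-(n-k)"] 
  by (simp add: fourier_coeff_mean)

lemma powi_circ_cnj: "cmod z = 1 \<Longrightarrow> cnj (z powi n) = z powi (- n)"
  using divide_conv_cnj[of z 1] 
  by (simp add: complex_cnj_power_int power_int_minus flip: power_int_inverse) (simp add: inverse_eq_divide)

lemma fourier_coeff_cnj: "fourier_coeff (\<lambda>z. cnj (g z)) n = cnj (fourier_coeff g (- n))"
proof -
  have "fourier_coeff (\<lambda>z. cnj (g z)) n = mean_T (\<lambda>z. cnj (g z * z powi n))"
    unfolding fourier_coeff_mean by (intro mean_T_cong) (simp only: complex_cnj_mult powi_circ_cnj)
  then show ?thesis by (simp only: mean_T_cnj fourier_coeff_mean minus_minus)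
qed

lemma L1_T_powi_mult: "L1_T g \<Longrightarrow> L1_T (\<lambda>z. g z * z powi n)"
  using L1_T_continuous_mult[OF continuous_on_powi_circ] by (simp add: mult.commute)

lemma fourier_coeff_add: 
  "L1_T f \<Longrightarrow> L1_T g \<Longrightarrow> fourier_coeff (\<lambda>z. f z + g z) n = fourier_coeff f n + fourier_coeff g n"
  unfolding fourier_coeff_mean by (subst mean_T_add[symmetric]) (auto simp: L1_T_powi_mult distrib_right)

lemma fourier_coeff_diff: 
  "L1_T f \<Longrightarrow> L1_T g \<Longrightarrow> fourier_coeff (\<lambda>z. f z - g z) n = fourier_coeff f n - fourier_coeff g n"
  unfolding fourier_coeff_mean by (subst mean_T_diff[symmetric]) (auto simp: L1_T_powi_mult left_diff_distrib)

lemma fourier_coeff_cmult: "fourier_coeff (\<lambda>z. c * f z) n = c * fourier_coeff f n"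
  unfolding fourier_coeff_mean by (subst mean_T_cmult[symmetric]) (simp add: mult.assoc)

lemma fourier_coeff_sum: 
  "(\<And>i. i \<in> I \<Longrightarrow> L1_T (f i)) \<Longrightarrow> fourier_coeff (\<lambda>z. \<Sum>i\<in>I. f i z) n = (\<Sum>i\<in>I. fourier_coeff (f i) n)"
  unfolding fourier_coeff_mean by (subst mean_T_sum[symmetric]) (auto simp: L1_T_powi_mult sum_distrib_right)

lemma norm_mean_T_le:
  assumes "L1_T g" "\<And>z. cmod z = 1 \<Longrightarrow> cmod (f z) \<le> C * cmod (g z)" "C \<ge> 0"
  shows "cmod (mean_T f) \<le> C * cmod (mean_T (\<lambda>z. of_real (cmod (g z))))"
proof (cases "integrable circM (\<lambda>t. f (cis t))")
  case True
  have ig: "integrable circM (\<lambda>t. cmod (g (cis t)))" using assms(1) by (simp add: L1_T_def on_circ_def)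
  have "cmod (LINT t|circM. f (cis t)) \<le> (LINT t|circM. C * cmod (g (cis t)))"
    by (rule order_trans[OF integral_norm_bound integral_mono])
       (use ig assms True in \<open>auto intro: integrable_norm\<close>)
  also have "\<dots> = C * cmod (LINT t|circM. complex_of_real (cmod (g (cis t))))"
    by simp
  finally show ?thesis by (simp add: mean_T_def norm_divide divide_right_mono)
\<comment> \<open>A non-integrable function has Bochner integral 0 by default, and the right-hand
  side is nonnegative.\<close>
qed (use assms(3) in \<open>simp add: mean_T_def not_integrable_integral_eq\<close>)

text \<open>Absolute summability is demanded, not just convergence at each point of the circle,
  because it permits termwise integration against an arbitrary L^1 function.\<close>

definition boundary_series :: "(complex \<Rightarrow> complex) \<Rightarrow> (nat \<Rightarrow> complex) \<Rightarrow> bool" where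
  "boundary_series \<phi> c \<longleftrightarrow> summable (\<lambda>j. norm (c j)) \<and> (\<forall>z. cmod z = 1 \<longrightarrow> (\<lambda>j. c j * z ^ j) sums \<phi> z)"

text \<open>Termwise integration is dominated by the summable norms of \<open>c\<close> times the
  L^1 norm of \<open>g\<close>, and the factor z^j moves frequency n to n - j. The result is the
  Cauchy product that drives all later statements on analytic multipliers.\<close>

lemma fourier_coeff_mult_sums:
  assumes \<phi>: "boundary_series \<phi> c" and g: "L1_T g"
  shows "(\<lambda>j. c j * fourier_coeff g (n - int j)) sums fourier_coeff (\<lambda>z. \<phi> z * g z) n"
proof -
  define h where "h = (\<lambda>z. g z * z powi (- n))"
  have h: "L1_T h" unfolding h_def by (rule L1_T_powi_mult[OF g])
  let ?f = "\<lambda>j t. (c j * cis t ^ j) * h (cis t)"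
  have int: "integrable circM (?f j)" for j
  proof -
    have "L1_T (\<lambda>z. (c j * z ^ j) * h z)"
      by (rule L1_T_continuous_mult[OF _ h]) (intro continuous_intros)
    then show ?thesis by (simp add: L1_T_def on_circ_def)
  qed
  have s: "summable (\<lambda>j. norm (c j))" using \<phi> by (simp add: boundary_series_def)
  have nrm: "norm (?f j t) = norm (c j) * norm (h (cis t))" for j t
    by (simp add: norm_mult norm_power)
  have sm: "(\<lambda>j. ?f j t) sums (\<phi> (cis t) * h (cis t))" for t
    using \<phi> by (intro sums_mult2) (simp add: boundary_series_def)
  have "(\<lambda>j. integral\<^sup>L circM (?f j)) sums (\<integral>t. (\<Sum>j. ?f j t) \<partial>circM)"
  proof (rule sums_integral[OF int])
    show "AE t in circM. summable (\<lambda>j. norm (?f j t))"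
      unfolding nrm by (intro AE_I2 summable_mult2 s)
    show "summable (\<lambda>j. \<integral>t. norm (?f j t) \<partial>circM)"
      unfolding nrm by (simp add: summable_mult2 s)
  qed
  then have "(\<lambda>j. integral\<^sup>L circM (?f j)) sums (\<integral>t. \<phi> (cis t) * h (cis t) \<partial>circM)"
    by (simp only: sums_unique[OF sm, symmetric])
  from sums_divide[OF this, of "of_real (2*pi)"]
  have "(\<lambda>j. mean_T (\<lambda>z. (c j * z ^ j) * h z)) sums mean_T (\<lambda>z. \<phi> z * h z)"
    by (simp add: mean_T_def)
  moreover have "mean_T (\<lambda>z. (c j * z ^ j) * h z) = c j * fourier_coeff g (n - int j)" for j
  proof -
    have "mean_T (\<lambda>z. (c j * z ^ j) * h z) = mean_T (\<lambda>z. c j * (g z * z powi (- (n - int j))))"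
    proof (rule mean_T_cong)
      fix z :: complex assume "cmod z = 1"
      then have "z \<noteq> 0" by auto
      then show "c j * z ^ j * h z = c j * (g z * z powi - (n - int j))"
        by (simp add: h_def power_int_diff power_int_minus field_simps)
    qed
    then show ?thesis by (simp add: mean_T_cmult fourier_coeff_mean)
  qed
  moreover have "fourier_coeff (\<lambda>z. \<phi> z * g z) n = mean_T (\<lambda>z. \<phi> z * h z)"
    by (simp add: fourier_coeff_mean h_def mult.assoc)
  ultimately show ?thesis by simp
qed

lemma fourier_coeff_boundary_series:
  assumes "boundary_series \<phi> c"
  shows "fourier_coeff \<phi> n = (if n \<ge> 0 then c (nat n) else 0)"
proof -
  have one: "fourier_coeff (\<lambda>_. 1) m = (if m = 0 then 1 else 0)" for m
    using fourier_coeff_powi[of 0 m] by simp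
  have "(\<lambda>j. c j * fourier_coeff (\<lambda>_. 1) (n - int j)) sums fourier_coeff (\<lambda>z. \<phi> z * 1) n"
    by (rule fourier_coeff_mult_sums[OF assms]) (auto intro: L1_T_continuous)
  moreover have "(\<lambda>j. c j * fourier_coeff (\<lambda>_. 1) (n - int j)) = (\<lambda>j. if n \<ge> 0 \<and> j = nat n then c j else 0)"
    unfolding one by (auto simp: fun_eq_iff)
  moreover have "(\<lambda>j. if n \<ge> 0 \<and> j = nat n then c j else 0) sums (if n \<ge> 0 then c (nat n) else 0)"
    using sums_single[of "nat n" c] by (cases "n \<ge> 0") auto
  ultimately show ?thesis using sums_unique2 by fastforce
qed

text \<open>Analyticity on the compact closed disc extends to a disc of radius 1 + e, so the Taylor
  series at 0 has radius of convergence greater than 1.\<close>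

lemma boundary_series_analytic:
  assumes "\<phi> analytic_on cball 0 1"
  shows "boundary_series \<phi> (\<lambda>j. (deriv ^^ j) \<phi> 0 / fact j)"
proof -
  obtain T where T: "open T" "cball 0 1 \<subseteq> T" "\<phi> holomorphic_on T"
    using assms by (auto simp: analytic_on_holomorphic)
  then obtain e where e: "e > 0" "{x. infdist x (cball 0 1) \<le> e} \<subseteq> T" 
    using compact_in_open_separated[of "cball (0::complex) 1" T] by auto
  have sub: "ball 0 (1 + e) \<subseteq> T"
  proof
    fix x :: complex assume x: "x \<in> ball 0 (1 + e)"
    show "x \<in> T"
    proof (cases "cmod x \<le> 1")
      case False
      \<comment> \<open>The radial projection x / |x| is the comparison point in the closed disc, at
        distance |x| - 1.\<close>
      have "infdist x (cball 0 1) \<le> dist x (x / of_real (cmod x))"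
        using False by (intro infdist_le) (auto simp: norm_divide)
      also have "\<dots> = cmod (x * (1 - 1 / of_real (cmod x)))"
        by (simp add: dist_norm right_diff_distrib)
      also have "\<dots> = cmod x * \<bar>1 - 1 / cmod x\<bar>"
        unfolding norm_mult by (metis norm_of_real of_real_1 of_real_diff of_real_divide)
      also have "\<dots> = cmod x - 1" using False by (auto simp: field_simps abs_if)
      finally show ?thesis using x e by (auto)
    qed (use T in auto)
  qed
  then have hol: "\<phi> holomorphic_on ball 0 (1 + e)" using T holomorphic_on_subset by blast
  have sums: "(\<lambda>n. (deriv ^^ n) \<phi> 0 / fact n * (w - 0) ^ n) sums \<phi> w" if "w \<in> ball 0 (1 + e)" for w
    by (rule holomorphic_power_series[OF hol that])
  have "summable (\<lambda>n. norm ((deriv ^^ n) \<phi> 0 / fact n * 1 ^ n))"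
  proof (rule powser_insidea)
    show "summable (\<lambda>n. (deriv ^^ n) \<phi> 0 / fact n * (of_real (1 + e/2)) ^ n)"
      using sums[of "of_real (1 + e/2)"] e by (auto simp: sums_iff simp del: of_real_add of_real_power)
    show "norm (1::complex) < norm (of_real (1 + e/2) :: complex)"
      using e by (simp del: of_real_add)
  qed
  then show ?thesis using sums e by (auto simp: boundary_series_def)
qed

section \<open>Uniqueness of Fourier coefficients\<close>

text \<open>Vanishing of all Fourier coefficients survives multiplication by z and by its conjugate,
  hence by every real polynomial in the coordinates; Stone-Weierstrass then reaches continuous
  multipliers.\<close>

lemma annihilated_by_continuous:
  assumes g: "L1_T g" and zero: "\<And>n. fourier_coeff g n = 0"
    and \<phi>: "continuous_on (sphere 0 1) \<phi>"
  shows "mean_T (\<lambda>z. of_real (\<phi> z) * g z) = 0"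
proof -
  \<comment> \<open>The factor \<open>h\<close> is general so that the product case can apply one
    hypothesis to the function produced by the other.\<close>
  have poly: "L1_T (\<lambda>z. of_real (p z) * h z) \<and> (\<forall>n. fourier_coeff (\<lambda>z. of_real (p z) * h z) n = 0)"
    if "real_polynomial_function p" "L1_T h" "\<And>n. fourier_coeff h n = 0" for p h
    using that
  proof (induction p arbitrary: h rule: real_polynomial_function.induct)
    case (linear p)
    have p: "p z = Re z * p 1 + Im z * p \<i>" for z
    proof -
      have "z = Re z *\<^sub>R 1 + Im z *\<^sub>R \<i>" by (simp add: complex_eq_iff)
      then have "p z = p (Re z *\<^sub>R 1 + Im z *\<^sub>R \<i>)" by simp
      then show ?thesis using linear(1) 
        by (simp add: linear_add linear_scale bounded_linear.linear)
    qed
    \<comment> \<open>With this \<open>a\<close> the real-linear form \<open>p\<close> is a z plus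
      its conjugate, and on the circle the conjugate of z is z^(-1).\<close>
    define a where "a = (of_real (p 1) - \<i> * of_real (p \<i>)) / 2"
    have eq: "of_real (p z) * h z = a * (z powi 1 * h z) + cnj a * (z powi (-1) * h z)" if "cmod z = 1" for z
    proof -
      have "of_real (p z) = a * z + cnj a * cnj z" 
        unfolding a_def p[of z] by (simp add: complex_eq_iff field_simps)
      moreover have "z powi (-1) = cnj z"
        using powi_circ_cnj[OF that, of 1] by simp
      ultimately show ?thesis by (simp add: algebra_simps)
    qed
    have i: "L1_T (\<lambda>z. c * (z powi k * h z))" for c k
      by (intro L1_T_cmult L1_T_continuous_mult continuous_on_powi_circ linear)
    have "L1_T (\<lambda>z. of_real (p z) * h z)"
      by (rule iffD2[OF L1_T_cong L1_T_add[OF i i]]) (rule eq)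
    moreover have "fourier_coeff (\<lambda>z. of_real (p z) * h z) n = 0" for n
    proof -
      have "fourier_coeff (\<lambda>z. of_real (p z) * h z) n 
          = fourier_coeff (\<lambda>z. a * (z powi 1 * h z) + cnj a * (z powi (-1) * h z)) n"
        unfolding fourier_coeff_mean by (intro mean_T_cong) (simp only: eq)
      also have "\<dots> = 0"
        by (simp only: fourier_coeff_add[OF i i] fourier_coeff_cmult fourier_coeff_powi_mult linear) simp
      finally show ?thesis .
    qed
    ultimately show ?case by blast
  next
    case (const c)
    then show ?case by (simp add: L1_T_cmult fourier_coeff_cmult)
  next
    case (add p q)
    from add.IH(1)[OF add.prems] add.IH(2)[OF add.prems] show ?case
      by (simp add: distrib_right L1_T_add fourier_coeff_add)
  next
    case (mult p q)
    from mult.IH(2)[OF mult.prems] have "L1_T (\<lambda>z. of_real (q z) * h z)" 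
      "\<And>n. fourier_coeff (\<lambda>z. of_real (q z) * h z) n = 0" by auto
    from mult.IH(1)[OF this] show ?case by (simp add: mult.assoc)
  qed
  have c\<phi>: "continuous_on (sphere 0 1) (\<lambda>z. complex_of_real (\<phi> z))" 
    by (intro continuous_intros \<phi>)
  define A where "A = cmod (mean_T (\<lambda>z. of_real (cmod (g z))))"
  have "cmod (mean_T (\<lambda>z. of_real (\<phi> z) * g z)) \<le> 0 + e" if "e > 0" for e
  proof -
    \<comment> \<open>\<open>A\<close> is the normalised L^1 norm of \<open>g\<close>; adding 1
      keeps the quotient meaningful when \<open>A\<close> is 0.\<close>
    define d where "d = e / (A + 1)"
    have A: "A \<ge> 0" by (simp add: A_def)
    then have d: "d > 0" using that by (simp add: d_def)
    then obtain p where p: "real_polynomial_function p" "\<And>z. z \<in> sphere 0 1 \<Longrightarrow> \<bar>\<phi> z - p z\<bar> < d"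
      using Stone_Weierstrass_real_polynomial_function[of "sphere (0::complex) 1" \<phi> d] \<phi> by auto
    from poly[OF p(1) g zero] have pg: "L1_T (\<lambda>z. of_real (p z) * g z)" "mean_T (\<lambda>z. of_real (p z) * g z) = 0"
      by (auto simp: fourier_coeff_mean dest!: spec[of _ 0])
    have "mean_T (\<lambda>z. of_real (\<phi> z) * g z) = mean_T (\<lambda>z. of_real (\<phi> z) * g z - of_real (p z) * g z)"
      using mean_T_diff[OF L1_T_continuous_mult[OF c\<phi> g] pg(1)] pg(2) by simp
    also have "cmod \<dots> \<le> d * cmod (mean_T (\<lambda>z. of_real (cmod (g z))))"
    proof (rule norm_mean_T_le[OF g])
      fix z :: complex assume "cmod z = 1"
      then have "cmod (of_real (\<phi> z - p z)) \<le> d" using p(2)[of z] unfolding norm_of_real by simp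
      then show "cmod (of_real (\<phi> z) * g z - of_real (p z) * g z) \<le> d * cmod (g z)"
        unfolding left_diff_distrib[symmetric] of_real_diff[symmetric] norm_mult by (rule mult_right_mono) simp
    qed (use d in simp)
    also have "\<dots> = e * (A / (A + 1))" by (simp add: A_def d_def)
    also have "\<dots> \<le> e * 1" using that A by (intro mult_left_mono) auto
    finally show ?thesis by simp
  qed
  then have "cmod (mean_T (\<lambda>z. of_real (\<phi> z) * g z)) \<le> 0" by (rule field_le_epsilon)
  then show ?thesis by simp
qed

lemma cis_inj_Ioo:
  assumes "cis s = cis t" "0 < s" "s < 2*pi" "0 < t" "t < 2*pi" shows "s = t"
proof -
  from assms(1) obtain n where n: "s = t + 2 * of_int n * pi"
    using sin_cos_eq_iff[of s t] by (auto simp: complex_eq_iff mult.assoc mult.commute)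
  have "\<bar>s - t\<bar> < 1 * (2 * pi)" using assms by linarith
  moreover have "s - t = of_int n * (2 * pi)" using n by simp
  ultimately have "\<bar>of_int n\<bar> * (2 * pi) < 1 * (2 * pi)" by (simp add: abs_mult)
  then have "\<bar>of_int n\<bar> < (1::real)" by simp
  then have "n = 0" by linarith
  then show ?thesis using n by simp
qed

text \<open>The indicator of the closed arc over [a, b] is the pointwise limit of the tents max(0, 1
  - n dist), which are continuous and bounded by 1, so dominated convergence transfers their
  vanishing integrals to the arc.\<close>

lemma integral_subinterval_zero:
  assumes g: "L1_T g" and zero: "\<And>n. fourier_coeff g n = 0" and ab: "0 < a" "a \<le> b" "b < 2*pi"
  shows "integral {a..b} (\<lambda>t. g (cis t)) = 0"
proof -
  define F where "F = cis ` {a..b}"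
  have F: "closed F" "F \<noteq> {}"
    unfolding F_def using ab
    by (auto intro!: compact_imp_closed compact_continuous_image continuous_intros)
  define \<phi> where "\<phi> = (\<lambda>n z. max 0 (1 - real n * infdist z F))"
  define G where "G = (\<lambda>t. g (cis t))"
  have G: "integrable circM G" using g by (simp add: L1_T_def on_circ_def G_def)
  have \<phi>c: "continuous_on (sphere 0 1) (\<phi> n)" for n
    unfolding \<phi>_def by (intro continuous_intros)
  have lim: "(\<lambda>n. \<phi> n z) \<longlonglongrightarrow> indicat_real F z" for z
  proof (cases "z \<in> F")
    case True
    then show ?thesis by (simp add: \<phi>_def)
  next
    case False
    then have pos: "infdist z F > 0" using F by (simp add: infdist_pos_not_in_closed)
    have "eventually (\<lambda>n. real n > 1 / infdist z F) sequentially"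
      by real_asymp
    then have "eventually (\<lambda>n. \<phi> n z = indicat_real F z) sequentially"
      by eventually_elim (use pos False in \<open>auto simp: \<phi>_def field_simps\<close>)
    then show ?thesis by (rule tendsto_eventually)
  qed
  have meas\<phi>: "(\<lambda>t. of_real (\<phi> n (cis t)) * G t) \<in> borel_measurable circM" for n
  proof -
    have "L1_T (\<lambda>z. of_real (\<phi> n z) * g z)"
      by (intro L1_T_continuous_mult g continuous_intros \<phi>c)
    then show ?thesis by (auto simp: L1_T_def on_circ_def G_def)
  qed
  have measF: "(\<lambda>t. of_real (indicat_real F (cis t)) * G t) \<in> borel_measurable circM"
  proof (rule borel_measurable_LIMSEQ_metric[OF meas\<phi>])
    show "(\<lambda>n. of_real (\<phi> n (cis t)) * G t) \<longlonglongrightarrow> of_real (indicat_real F (cis t)) * G t" for t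
      by (intro tendsto_intros lim)
  qed
  have "(\<lambda>n. LINT t|circM. of_real (\<phi> n (cis t)) * G t) \<longlonglongrightarrow> (LINT t|circM. of_real (indicat_real F (cis t)) * G t)"
  proof (rule integral_dominated_convergence[where w="\<lambda>t. norm (G t)"])
    show "(\<lambda>t. of_real (indicat_real F (cis t)) * G t) \<in> borel_measurable circM" by (rule measF)
    show "(\<lambda>t. of_real (\<phi> n (cis t)) * G t) \<in> borel_measurable circM" for n by (rule meas\<phi>)
    show "AE t in circM. (\<lambda>n. of_real (\<phi> n (cis t)) * G t) \<longlonglongrightarrow> of_real (indicat_real F (cis t)) * G t"
      by (intro AE_I2 tendsto_intros lim)
    show "AE t in circM. norm (of_real (\<phi> n (cis t)) * G t) \<le> norm (G t)" for n
    proof (intro AE_I2)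
      fix t
      have "\<bar>\<phi> n (cis t)\<bar> \<le> 1" by (auto simp: \<phi>_def infdist_nonneg)
      then show "norm (of_real (\<phi> n (cis t)) * G t) \<le> norm (G t)"
        by (simp add: norm_mult mult_left_le_one_le)
    qed
  qed (use G in \<open>auto intro: integrable_norm\<close>)
  moreover have "(LINT t|circM. of_real (\<phi> n (cis t)) * G t) = 0" for n
    using annihilated_by_continuous[OF g zero \<phi>c, of n] by (simp add: mean_T_def G_def)
  ultimately have 0: "(LINT t|circM. of_real (indicat_real F (cis t)) * G t) = 0"
    by (simp add: LIMSEQ_const_iff)
  have int: "integrable circM (\<lambda>t. indicat_real {a..b} t *\<^sub>R G t)"
  proof (rule integrable_mult_indicator[OF _ G])
    have "{a..b} = {0..2*pi} \<inter> {a..b}" using ab by auto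
    then show "{a..b} \<in> sets circM"
      unfolding circM_def sets_restrict_space by (intro image_eqI[of _ _ "{a..b}"]) auto
  qed
  \<comment> \<open>Without the endpoints, \<open>cis\<close> is injective, so membership in the arc
    and in the interval agree.\<close>
  have "AE t in circM. t \<noteq> 0 \<and> t \<noteq> 2*pi"
  proof -
    have "AE t in lebesgue. t \<notin> {0, 2*pi}"
      by (rule AE_not_in) auto
    then show ?thesis unfolding circM_def
      by (subst AE_restrict_space_iff) (auto elim: eventually_mono)
  qed
  moreover have "AE t in circM. 0 \<le> t \<and> t \<le> 2*pi" by (intro AE_I2) simp
  ultimately have ae: "AE t in circM. indicat_real {a..b} t *\<^sub>R G t = of_real (indicat_real F (cis t)) * G t"
  proof eventually_elim
    case (elim t)
    then have "cis t \<in> F \<longleftrightarrow> t \<in> {a..b}"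
      unfolding F_def using ab cis_inj_Ioo[of t] by (auto simp: image_iff)
    then show ?case by (simp add: indicator_def)
  qed
  have "integral {a..b} G = integral {0..2*pi} (\<lambda>t. indicat_real {a..b} t *\<^sub>R G t)"
  proof -
    have "{a..b} \<inter> {0..2*pi} = {a..b}" using ab by auto
    then show ?thesis
      using integral_restrict_Int[of "{0..2*pi}" "{a..b}" G] 
      by (simp add: indicator_scaleR_eq_if del: Int_atLeastAtMost)
  qed
  also have "\<dots> = (LINT t|circM. indicat_real {a..b} t *\<^sub>R G t)"
    using int unfolding circM_def by (intro lebesgue_integral_eq_integral[symmetric]) auto
  also have "\<dots> = (LINT t|circM. of_real (indicat_real F (cis t)) * G t)"
  proof -
    have m: "(\<lambda>t. indicat_real {a..b} t *\<^sub>R G t) \<in> borel_measurable circM" using int by auto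
    show ?thesis
    proof (rule integral_cong_AE[OF m _ ae])
      show "(\<lambda>t. of_real (indicat_real F (cis t)) * G t) \<in> borel_measurable circM" by (rule measF)
    qed
  qed
  finally show ?thesis using 0 by (simp add: G_def)
qed

text \<open>By Lebesgue differentiation, at almost every x the value of the function is the limit of
  its averages over [x, x+h], and all these averages vanish by the preceding lemma.\<close>

theorem fourier_uniqueness:
  assumes g: "L1_T g" and zero: "\<And>n. fourier_coeff g n = 0"
  shows "AE t in circM. g (cis t) = 0"
proof -
  define f where "f = (\<lambda>t. if t \<in> {0..2*pi} then g (cis t) else 0)"
  have "integrable (lebesgue_on {0..2*pi}) (\<lambda>t. g (cis t))" using g by (simp add: L1_T_def on_circ_def circM_def)
  then have "(\<lambda>t. g (cis t)) integrable_on {0..2*pi}"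
    by (intro integrable_on_lebesgue_on) auto
  then have "f integrable_on UNIV" unfolding f_def by (subst integrable_restrict_UNIV)
  then have "f integrable_on cbox a b" for a b using integrable_on_subcbox by blast
  from integrable_ccontinuous_explicit[OF this] obtain N where N: "negligible N"
    "\<And>x e. \<lbrakk>x \<notin> N; 0 < e\<rbrakk> \<Longrightarrow> \<exists>d>0. \<forall>h. 0 < h \<and> h < d \<longrightarrow>
        norm (integral (cbox x (x + h *\<^sub>R One)) f /\<^sub>R h ^ DIM(real) - f x) < e" by metis
  have z: "g (cis x) = 0" if x: "x \<notin> N" "0 < x" "x < 2*pi" for x
  proof (rule ccontr)
    assume nz: "g (cis x) \<noteq> 0"
    then have "norm (g (cis x)) > 0" by simp
    from N(2)[OF x(1) this] obtain d where d: "d > 0" "\<And>h. 0 < h \<and> h < d \<Longrightarrow>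
        norm (integral (cbox x (x + h *\<^sub>R One)) f /\<^sub>R h ^ DIM(real) - f x) < norm (g (cis x))" by metis
    define h where "h = min d (2*pi - x) / 2"
    have h: "0 < h" "h < d" "x + h < 2*pi" using d x by (auto simp: h_def min_def field_simps)
    have "integral {x..x+h} f = integral {x..x+h} (\<lambda>t. g (cis t))"
      by (rule integral_cong) (use x h in \<open>auto simp: f_def\<close>)
    also have "\<dots> = 0" by (rule integral_subinterval_zero[OF g zero]) (use x h in auto)
    finally have "integral (cbox x (x + h *\<^sub>R One)) f = 0" by simp
    with d(2)[of h] h x nz show False by (simp add: f_def)
  qed
  have "AE t in lebesgue. t \<notin> N \<union> {0, 2*pi}"
    using N(1) by (intro AE_not_in) (simp add: negligible_iff_null_sets negligible_Un)
  then show ?thesis unfolding circM_def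
    by (subst AE_restrict_space_iff) (simp, rule eventually_mono, auto simp: z less_le)
qed

section \<open>Finite Blaschke products on the circle\<close>

text \<open>The unimodular constant left over when a factor is written with z - w in the numerator:
  the sign comes from reversing w - z, and the value 1 at w = 0 makes one formula cover both
  clauses.\<close>

definition blaschke_unit :: "complex \<Rightarrow> complex" where
  "blaschke_unit w = (if w = 0 then 1 else - (of_real (cmod w) / w))"

lemma norm_blaschke_unit [simp]: "cmod (blaschke_unit w) = 1"
  by (simp add: blaschke_unit_def norm_divide)

lemma blaschke_factor_eq: "blaschke_factor w z = blaschke_unit w * ((z - w) / (1 - cnj w * z))"
proof (cases "w = 0")
  case False
  have "(w - z) / (1 - cnj w * z) = - ((z - w) / (1 - cnj w * z))"
    by (simp add: minus_divide_left)
  with False show ?thesis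
    by (simp only: blaschke_factor_def blaschke_unit_def if_False mult_minus_right mult_minus_left)
qed (simp add: blaschke_factor_def blaschke_unit_def)

lemma one_minus_cnj_mult_nonzero:
  assumes "cmod w < 1" "cmod z \<le> 1" shows "1 - cnj w * z \<noteq> 0"
proof
  assume "1 - cnj w * z = 0"
  then have "cmod (cnj w * z) = 1" by simp
  moreover have "cmod w * cmod z \<le> cmod w * 1" using assms by (intro mult_left_mono) auto
  ultimately show False using assms by (simp add: norm_mult)
qed

text \<open>On the circle z times its conjugate is 1. This reflection identity is behind |b| = 1,
  the Poisson form of the derivative and the moving of roots across the circle.\<close>

lemma circ_factor:
  assumes "cmod z = 1" shows "1 - cnj w * z = z * cnj (z - w)"
  using complex_norm_square[of z] assms by (simp add: algebra_simps)

lemma norm_circ_factor: "cmod z = 1 \<Longrightarrow> cmod (1 - cnj w * z) = cmod (z - w)"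
  by (simp only: circ_factor norm_mult complex_mod_cnj)

lemma norm_blaschke_factor_circ:
  assumes "cmod w < 1" "cmod z = 1" shows "cmod (blaschke_factor w z) = 1"
proof -
  have "cmod (z - w) \<noteq> 0" using assms by auto
  then show ?thesis using assms
    by (simp add: blaschke_factor_eq norm_mult norm_divide norm_circ_factor)
qed

lemma norm_blaschke_factor_disc:
  assumes "cmod w < 1" "cmod z < 1" shows "cmod (blaschke_factor w z) < 1"
  using Moebius_function_norm_lt_1[OF assms, of 0]
  by (simp add: blaschke_factor_eq norm_mult norm_divide Moebius_function_def)

lemma analytic_blaschke_factor:
  assumes "cmod w < 1" shows "blaschke_factor w analytic_on cball 0 1"
  unfolding blaschke_factor_eq[abs_def]
  by (intro analytic_intros) (use one_minus_cnj_mult_nonzero[OF assms] in auto)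

text \<open>The sum of the Poisson kernels of the zeros. On the circle it is z b'(z) / b(z), the
  derivative of the argument of b, so its positivity makes that argument strictly increasing and ln
  J_0 finite.\<close>

definition poisson_sum :: "nat \<Rightarrow> (nat \<Rightarrow> complex) \<Rightarrow> complex \<Rightarrow> real" where
  "poisson_sum N \<alpha> z = (\<Sum>j<N. (1 - (cmod (\<alpha> j))\<^sup>2) / (cmod (z - \<alpha> j))\<^sup>2)"

context
  fixes N :: nat and \<alpha> :: "nat \<Rightarrow> complex"
  assumes zeros: "\<forall>j<N. \<alpha> j \<in> ball 0 1"
begin

lemma analytic_blaschke: "blaschke N \<alpha> analytic_on cball 0 1"
  unfolding blaschke_def[abs_def]
  by (intro analytic_on_prod analytic_blaschke_factor) (use zeros in auto)

lemma norm_blaschke_circ: "cmod z = 1 \<Longrightarrow> cmod (blaschke N \<alpha> z) = 1"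
  unfolding blaschke_def prod_norm[symmetric] using zeros
  by (intro prod.neutral) (auto simp: norm_blaschke_factor_circ)

lemma norm_blaschke_disc:
  assumes "N \<ge> 1" "cmod z < 1" shows "cmod (blaschke N \<alpha> z) < 1"
proof -
  have "cmod (blaschke N \<alpha> z) = (\<Prod>j<N. cmod (blaschke_factor (\<alpha> j) z))"
    unfolding blaschke_def by (rule prod_norm[symmetric])
  also have "\<dots> = cmod (blaschke_factor (\<alpha> 0) z) * (\<Prod>j\<in>{..<N} - {0}. cmod (blaschke_factor (\<alpha> j) z))"
    using assms(1) by (intro prod.remove) auto
  also have "\<dots> \<le> cmod (blaschke_factor (\<alpha> 0) z) * 1"
    by (intro mult_left_mono prod_le_1) 
       (use zeros norm_blaschke_factor_disc[OF _ assms(2)] in \<open>auto intro: less_imp_le\<close>)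
  also have "\<dots> < 1" using norm_blaschke_factor_disc[OF _ assms(2)] assms(1) zeros by simp
  finally show ?thesis .
qed

lemma poisson_sum_pos:
  assumes "N \<ge> 1" "cmod z = 1" shows "poisson_sum N \<alpha> z > 0"
  unfolding poisson_sum_def
proof (rule sum_pos)
  fix j assume "j \<in> {..<N}"
  then have "cmod (\<alpha> j) < 1" using zeros by auto
  then show "(1 - (cmod (\<alpha> j))\<^sup>2) / (cmod (z - \<alpha> j))\<^sup>2 > 0"
    using assms(2) by (intro divide_pos_pos) (auto simp: power_less_one_iff abs_square_less_1)
qed (use assms in \<open>auto simp: lessThan_empty_iff\<close>)

lemma continuous_poisson_sum: "continuous_on (sphere 0 1) (poisson_sum N \<alpha>)"
  unfolding poisson_sum_def[abs_def] by (intro continuous_intros) (use zeros in auto)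

end

text \<open>The logarithmic derivative of a factor is (1 - |w|^2) / ((z - w)(1 -
  \<open>cnj w\<close> z)), and by \<open>circ_factor\<close> the denominator equals z |z - w|^2 on
  the circle.\<close>

lemma DERIV_blaschke_factor:
  assumes "cmod w < 1" "cmod z = 1"
  shows "(blaschke_factor w has_field_derivative
           blaschke_factor w z * of_real ((1 - (cmod w)\<^sup>2) / (cmod (z - w))\<^sup>2) / z) (at z)"
proof -
  have nz: "1 - cnj w * z \<noteq> 0" "z \<noteq> 0" "z - w \<noteq> 0" 
    using one_minus_cnj_mult_nonzero[of w z] assms by auto
  have cn: "z * cnj (z - w) = 1 - cnj w * z" using circ_factor[OF assms(2)] by simp
  have "((\<lambda>z. blaschke_unit w * ((z - w) / (1 - cnj w * z))) has_field_derivative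
          blaschke_unit w * ((1 * (1 - cnj w * z) - (z - w) * (- cnj w)) / ((1 - cnj w * z) * (1 - cnj w * z)))) (at z)"
    by (rule derivative_eq_intros refl | use nz in simp)+
  moreover have "1 * (1 - cnj w * z) - (z - w) * (- cnj w) = of_real (1 - (cmod w)\<^sup>2)"
    using complex_norm_square[of w] by (simp add: algebra_simps)
  moreover have "blaschke_unit w * (of_real (1 - (cmod w)\<^sup>2) / ((1 - cnj w * z) * (1 - cnj w * z)))
      = blaschke_factor w z * of_real ((1 - (cmod w)\<^sup>2) / (cmod (z - w))\<^sup>2) / z"
  proof -
    have "complex_of_real ((cmod (z - w))\<^sup>2) * z = (z - w) * (1 - cnj w * z)"
      using complex_norm_square[of "z - w"] cn by (simp add: mult_ac)
    then have "of_real ((1 - (cmod w)\<^sup>2) / (cmod (z - w))\<^sup>2) / z = of_real (1 - (cmod w)\<^sup>2) / ((z - w) * (1 - cnj w * z))"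
      by (simp only: of_real_divide divide_divide_eq_left)
    note eq = this
    have alg: "u * (b / a) * (c / (b * a)) = u * (c / (a * a))" if "a \<noteq> 0" "b \<noteq> 0" for a b c u :: complex
      using that by (simp add: field_simps)
    have "blaschke_factor w z * of_real ((1 - (cmod w)\<^sup>2) / (cmod (z - w))\<^sup>2) / z
        = blaschke_factor w z * (of_real ((1 - (cmod w)\<^sup>2) / (cmod (z - w))\<^sup>2) / z)"
      by (rule times_divide_eq_right[symmetric])
    then show ?thesis unfolding eq blaschke_factor_eq using alg[OF nz(1,3)] by simp
  qed
  ultimately show ?thesis by (simp only: blaschke_factor_eq[abs_def])
qed

lemma DERIV_blaschke:
  assumes "\<forall>j<N. \<alpha> j \<in> ball 0 1" "cmod z = 1"
  shows "(blaschke N \<alpha> has_field_derivative blaschke N \<alpha> z * of_real (poisson_sum N \<alpha> z) / z) (at z)"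
  using assms(1)
proof (induction N)
  case 0
  then show ?case by (simp add: blaschke_def[abs_def] poisson_sum_def)
next
  case (Suc N)
  then have "(blaschke N \<alpha> has_field_derivative blaschke N \<alpha> z * of_real (poisson_sum N \<alpha> z) / z) (at z)"
    and "cmod (\<alpha> N) < 1" by auto
  from DERIV_mult[OF this(1) DERIV_blaschke_factor[OF this(2) assms(2)]]
  have "((\<lambda>z. blaschke N \<alpha> z * blaschke_factor (\<alpha> N) z) has_field_derivative
     (blaschke N \<alpha> z * blaschke_factor (\<alpha> N) z) * of_real (poisson_sum (Suc N) \<alpha> z) / z) (at z)"
    by (rule DERIV_cong) (simp add: poisson_sum_def field_simps add_divide_distrib)
  then show ?case by (simp add: blaschke_def[abs_def])
qed

section \<open>The modulus of J_0 on the circle and its logarithm\<close>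

lemma J0_blaschke:
  assumes "\<forall>j<N. \<alpha> j \<in> ball 0 1" "cmod z = 1"
  shows "J0 N (blaschke N \<alpha>) z = of_real (poisson_sum N \<alpha> z / N)"
proof -
  have "blaschke N \<alpha> z \<noteq> 0" "z \<noteq> 0" using norm_blaschke_circ[OF assms] assms(2) by auto
  then show ?thesis unfolding J0_def DERIV_imp_deriv[OF DERIV_blaschke[OF assms]] by simp
qed

text \<open>Roots are split off one at a time. A root r inside the disc is reflected, |z - r| = |1 -
  \<open>cnj r\<close> z| on the circle; a root outside is scaled, |z - r| = |r| |1 - z/r|. Either
  way there remains 1 - s z with |s| < 1, which has positive real part on the closed disc, so its
  principal logarithm is analytic there.\<close>

lemma ln_norm_poly_circ:
  assumes "\<And>z. cmod z = 1 \<Longrightarrow> poly P z \<noteq> 0"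
  shows "\<exists>h. h analytic_on cball 0 1 \<and> (\<forall>z. cmod z = 1 \<longrightarrow> ln (cmod (poly P z)) = Re (h z))"
  using assms
proof (induction "degree P" arbitrary: P)
  case 0
  then obtain c where P: "P = [:c:]" by (metis degree_eq_zeroE)
  show ?case by (rule exI[of _ "\<lambda>_. of_real (ln (cmod c))"]) (simp add: P)
next
  case (Suc n)
  have log: "\<exists>h. h analytic_on cball 0 1 \<and> (\<forall>z. cmod z = 1 \<longrightarrow> ln (cmod (1 - s * z)) = Re (h z))"
    if s: "cmod s < 1" for s
  proof -
    have re: "Re (1 - s * z) > 0" if "cmod z \<le> 1" for z
    proof -
      have "cmod (s * z) < 1" 
        unfolding norm_mult using s that mult_left_mono[of "cmod z" 1 "cmod s"] by simp
      then have "Re (s * z) < 1" using complex_Re_le_cmod[of "s * z"] by linarith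
      then show ?thesis by simp
    qed
    then have "(\<lambda>z. Ln (1 - s * z)) analytic_on cball 0 1"
      by (intro analytic_intros) (use re in \<open>fastforce simp: complex_nonpos_Reals_iff simp del: minus_complex.sel times_complex.sel\<close>)
    moreover have "ln (cmod (1 - s * z)) = Re (Ln (1 - s * z))" if "cmod z = 1" for z
    proof -
      have "1 - s * z \<noteq> 0" using re[of z] that by (metis less_irrefl order.refl zero_complex.sel(1))
      then show ?thesis by (rule Re_Ln[symmetric])
    qed
    ultimately show ?thesis by blast
  qed
  obtain r where r: "poly P r = 0"
  proof (rule fundamental_theorem_of_algebra[of "coeff P" "degree P"])
    have "coeff P (degree P) \<noteq> 0" using Suc.hyps(2) by auto
    then show "coeff P 0 = 0 \<or> (\<exists>i\<in>{1..degree P}. coeff P i \<noteq> 0)"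
      using Suc.hyps(2) by (intro disjI2 bexI[of _ "degree P"]) auto
  qed (auto simp: poly_altdef)
  then obtain Q where Q: "P = [:-r, 1:] * Q" by (metis dvdE poly_eq_0_iff_dvd)
  have "Q \<noteq> 0" using Q Suc.hyps(2) by auto
  then have "degree Q = n" using Suc.hyps(2) unfolding Q by (subst (asm) degree_mult_eq) auto
  moreover have Qz: "poly Q z \<noteq> 0" if "cmod z = 1" for z using Suc.prems[OF that] by (simp add: Q)
  ultimately obtain h where h: "h analytic_on cball 0 1" "\<forall>z. cmod z = 1 \<longrightarrow> ln (cmod (poly Q z)) = Re (h z)"
    using Suc.hyps(1)[of Q] by auto
  have r1: "cmod r \<noteq> 1" using Suc.prems r by blast
  have "\<exists>k. k analytic_on cball 0 1 \<and> (\<forall>z. cmod z = 1 \<longrightarrow> ln (cmod (z - r)) = Re (k z))"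
  proof (cases "cmod r < 1")
    case True
    then show ?thesis using log[of "cnj r"] by (simp add: norm_circ_factor)
  next
    case False
    then have rg: "cmod r > 1" using r1 by linarith
    then have "cmod (1 / r) < 1" by (simp add: norm_divide divide_less_eq)
    from log[OF this] obtain k where k: "k analytic_on cball 0 1" 
      "\<forall>z. cmod z = 1 \<longrightarrow> ln (cmod (1 - 1 / r * z)) = Re (k z)" by blast
    have "ln (cmod (z - r)) = Re (of_real (ln (cmod r)) + k z)" if z: "cmod z = 1" for z
    proof -
      have rz: "r \<noteq> 0" "z \<noteq> r" using rg z by auto
      then have "cmod (z - r) = cmod r * cmod (1 - 1 / r * z)"
        by (simp add: norm_mult[symmetric] right_diff_distrib norm_minus_commute)
      moreover have "1 - 1 / r * z \<noteq> 0" using rz by (auto simp: field_simps)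
      ultimately show ?thesis using k(2) z rz by (simp add: ln_mult)
    qed
    moreover have "(\<lambda>z. of_real (ln (cmod r)) + k z) analytic_on cball 0 1"
      by (intro analytic_intros k)
    ultimately show ?thesis by blast
  qed
  then obtain k where k: "k analytic_on cball 0 1" "\<forall>z. cmod z = 1 \<longrightarrow> ln (cmod (z - r)) = Re (k z)"
    by blast
  have "ln (cmod (poly P z)) = Re (k z + h z)" if z: "cmod z = 1" for z
  proof -
    have "z \<noteq> r" using r1 z by auto
    moreover have "poly P z = (z - r) * poly Q z" by (simp add: Q algebra_simps)
    ultimately show ?thesis using Qz[OF z] k(2) h(2) z by (simp add: norm_mult ln_mult)
  qed
  moreover have "(\<lambda>z. k z + h z) analytic_on cball 0 1" by (intro analytic_intros k h)
  ultimately show ?case by (intro exI[of _ "\<lambda>z. k z + h z"]) auto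
qed

definition blaschke_den :: "nat \<Rightarrow> (nat \<Rightarrow> complex) \<Rightarrow> complex poly" where
  "blaschke_den N \<alpha> = (\<Prod>j<N. [:1, - cnj (\<alpha> j):])"

definition blaschke_num :: "nat \<Rightarrow> (nat \<Rightarrow> complex) \<Rightarrow> complex poly" where
  "blaschke_num N \<alpha> = (\<Prod>j<N. smult (blaschke_unit (\<alpha> j)) [:- \<alpha> j, 1:])"

lemma blaschke_quotient: "blaschke N \<alpha> z = poly (blaschke_num N \<alpha>) z / poly (blaschke_den N \<alpha>) z"
  by (simp add: blaschke_def blaschke_num_def blaschke_den_def poly_prod blaschke_factor_eq 
      algebra_simps flip: prod_dividef)

lemma blaschke_den_nonzero:
  assumes "\<forall>j<N. \<alpha> j \<in> ball 0 1" "cmod z \<le> 1" shows "poly (blaschke_den N \<alpha>) z \<noteq> 0"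
  using assms one_minus_cnj_mult_nonzero[OF _ assms(2)] 
  by (force simp: blaschke_den_def poly_prod mult.commute)

text \<open>Each numerator z - w is z times the conjugate of the denominator 1 -
  \<open>cnj w\<close> z. This form turns orthogonality to b H^2 into a bound on the frequencies of
  q d, with q the denominator polynomial.\<close>

lemma blaschke_times_den:
  assumes "\<forall>j<N. \<alpha> j \<in> ball 0 1" "cmod z = 1"
  shows "blaschke N \<alpha> z * poly (blaschke_den N \<alpha>) z 
       = (\<Prod>j<N. blaschke_unit (\<alpha> j)) * (z ^ N * cnj (poly (blaschke_den N \<alpha>) z))"
proof -
  have eq: "z - w = z * cnj (1 - cnj w * z)" for w 
    unfolding circ_factor[OF assms(2)] using complex_norm_square[of z] assms(2)
    by (simp add: algebra_simps)
  have "poly (blaschke_num N \<alpha>) z = (\<Prod>j<N. blaschke_unit (\<alpha> j) * (z - \<alpha> j))"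
    by (simp add: blaschke_num_def poly_prod algebra_simps)
  also have "\<dots> = (\<Prod>j<N. blaschke_unit (\<alpha> j) * (z * cnj (1 - cnj (\<alpha> j) * z)))"
    by (simp only: eq[symmetric])
  also have "\<dots> = (\<Prod>j<N. blaschke_unit (\<alpha> j)) * (z ^ N * cnj (poly (blaschke_den N \<alpha>) z))"
    by (simp add: prod.distrib blaschke_den_def poly_prod mult.commute)
  finally show ?thesis 
    using blaschke_den_nonzero[OF assms(1), of z] assms(2) by (simp add: blaschke_quotient)
qed

text \<open>With b = p / q, the quotient rule gives |J_0| = |P| / (N |q|^2) on the circle, where P =
  p' q - p q'. P has no zero there because the Poisson sum is positive, so
  \<open>ln_norm_poly_circ\<close> applies to P and to q.\<close>

lemma half_ln_J0_harmonic:
  assumes N: "N \<ge> 1" and zeros: "\<forall>j<N. \<alpha> j \<in> ball 0 1"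
  shows "\<exists>h. h analytic_on cball 0 1 \<and> Im (h 0) = 0 \<and>
           (\<forall>z. cmod z = 1 \<longrightarrow> ln (cmod (J0 N (blaschke N \<alpha>) z)) / 2 = Re (h z))"
proof -
  define p q where "p = blaschke_num N \<alpha>" "q = blaschke_den N \<alpha>"
  define P where "P = pderiv p * q - p * pderiv q"
  have q: "poly q z \<noteq> 0" if "cmod z = 1" for z
    using blaschke_den_nonzero[OF zeros, of z] that by (simp add: p_q_def)
  have nJ: "cmod (J0 N (blaschke N \<alpha>) z) = cmod (poly P z) / (real N * (cmod (poly q z))\<^sup>2)" if z: "cmod z = 1" for z
  proof -
    have "((\<lambda>z. poly p z / poly q z) has_field_derivative poly P z / (poly q z)\<^sup>2) (at z)"
      unfolding P_def using q[OF z] by (auto intro!: derivative_eq_intros simp: power2_eq_square)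
    moreover have "blaschke N \<alpha> = (\<lambda>z. poly p z / poly q z)"
      by (simp add: fun_eq_iff blaschke_quotient p_q_def)
    ultimately have "deriv (blaschke N \<alpha>) z = poly P z / (poly q z)\<^sup>2"
      by (simp add: DERIV_imp_deriv)
    then show ?thesis using z norm_blaschke_circ[OF zeros z]
      by (simp add: J0_def norm_mult norm_divide norm_power)
  qed
  have nz: "cmod (J0 N (blaschke N \<alpha>) z) > 0" if "cmod z = 1" for z
    using J0_blaschke[OF zeros that] poisson_sum_pos[OF zeros N that] N by simp
  have P: "poly P z \<noteq> 0" if "cmod z = 1" for z
    using nJ[OF that] nz[OF that] by auto
  obtain h where h: "h analytic_on cball 0 1" "\<forall>z. cmod z = 1 \<longrightarrow> ln (cmod (poly P z)) = Re (h z)"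
    using ln_norm_poly_circ[OF P] by blast
  obtain k where k: "k analytic_on cball 0 1" "\<forall>z. cmod z = 1 \<longrightarrow> ln (cmod (poly q z)) = Re (k z)"
    using ln_norm_poly_circ[OF q] by blast
  define H where "H = (\<lambda>z. (h z - of_real (ln N) - 2 * k z) / 2)"
  \<comment> \<open>An imaginary constant leaves the real part alone; removing it matches the
    Herglotz integral, whose value at 0 is real.\<close>
  define H' where "H' = (\<lambda>z. H z - \<i> * of_real (Im (H 0)))"
  have "H analytic_on cball 0 1" unfolding H_def by (intro analytic_intros h k) auto
  then have "H' analytic_on cball 0 1" unfolding H'_def by (intro analytic_intros)
  moreover have "Im (H' 0) = 0" by (simp add: H'_def)
  moreover have "ln (cmod (J0 N (blaschke N \<alpha>) z)) / 2 = Re (H' z)" if z: "cmod z = 1" for z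
    using N P[OF z] q[OF z] h(2) k(2) z unfolding nJ[OF z]
    by (simp add: H'_def H_def ln_div ln_mult ln_realpow)
  ultimately show ?thesis by blast
qed

section \<open>Outer functions\<close>

text \<open>The kernel is 2 / (1 - w z) - 1, a doubled geometric series with its constant term
  lowered from 2 to 1.\<close>

lemma boundary_series_herglotz:
  assumes "cmod w < 1"
  shows "boundary_series (\<lambda>z. (1 + w * z) / (1 - w * z)) (\<lambda>j. if j = 0 then 1 else 2 * w ^ j)"
  unfolding boundary_series_def
proof (intro conjI allI impI)
  have "summable (\<lambda>j. 2 * cmod w ^ j)" using assms by (intro summable_mult summable_geometric) auto
  then show "summable (\<lambda>j. norm (if j = 0 then 1 else 2 * w ^ j))"
    by (rule summable_comparison_test'[where N=0]) (auto simp: norm_mult norm_power)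
  fix z :: complex assume z: "cmod z = 1"
  then have wz: "cmod (w * z) < 1" using assms by (simp add: norm_mult)
  then have nz: "1 - w * z \<noteq> 0" by auto
  have "(\<lambda>j. 2 * (w * z) ^ j - (if j = 0 then 1 else 0)) sums (2 * (1 / (1 - w * z)) - 1)"
    by (intro sums_diff sums_mult geometric_sums wz sums_If_finite_set[of "{0::nat}" "\<lambda>_. 1::complex", simplified])
  moreover have "(\<lambda>j. 2 * (w * z) ^ j - (if j = 0 then 1 else 0)) = (\<lambda>j. (if j = 0 then 1 else 2 * w ^ j) * z ^ j)"
    by (auto simp: fun_eq_iff power_mult_distrib)
  moreover have "2 * (1 / (1 - w * z)) - 1 = (1 + w * z) / (1 - w * z)"
    using nz by (simp add: field_simps)
  ultimately show "(\<lambda>j. (if j = 0 then 1 else 2 * w ^ j) * z ^ j) sums ((1 + w * z) / (1 - w * z))"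
    by simp
qed

lemma analytic_circ_continuous: "h analytic_on cball 0 1 \<Longrightarrow> continuous_on (sphere 0 1) h"
  by (meson analytic_imp_holomorphic continuous_on_subset holomorphic_on_imp_continuous_on sphere_cball)

lemma sums_analytic_disc:
  assumes "h analytic_on cball 0 1" "cmod z < 1"
  shows "(\<lambda>j. fourier_coeff h (int j) * z ^ j) sums h z"
proof -
  have "h holomorphic_on ball 0 1"
    using assms(1) analytic_imp_holomorphic holomorphic_on_subset ball_subset_cball by blast
  from holomorphic_power_series[OF this, of z] show ?thesis
    using assms by (simp add: fourier_coeff_boundary_series[OF boundary_series_analytic[OF assms(1)]])
qed

lemma fourier_coeff_analytic_neg:
  "h analytic_on cball 0 1 \<Longrightarrow> n < 0 \<Longrightarrow> fourier_coeff h n = 0"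
  by (simp add: fourier_coeff_boundary_series[OF boundary_series_analytic])

text \<open>Schwarz's formula, obtained by expanding the conjugate of the Herglotz kernel in a power series.\<close>

lemma outer_fun_Re:
  assumes h: "h analytic_on cball 0 1" "Im (h 0) = 0" and u: "\<And>z. cmod z = 1 \<Longrightarrow> u z = Re (h z)"
    and z: "cmod z < 1"
  shows "outer_fun u z = exp (h z)"
proof -
  define c where "c = (\<lambda>j::nat. if j = 0 then 1 else 2 * cnj z ^ j)"
  define K where "K = (\<lambda>w. (1 + cnj z * w) / (1 - cnj z * w))"
  define a where "a = (\<lambda>j. fourier_coeff h (int j))"
  have K: "boundary_series K c"
    unfolding K_def c_def by (rule boundary_series_herglotz) (use z in simp)
  have hc: "continuous_on (sphere 0 1) h" by (rule analytic_circ_continuous[OF h(1)])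
  have L: "L1_T h" "L1_T (\<lambda>w. cnj (h w))" by (intro L1_T_continuous continuous_intros hc)+
  have Kc: "continuous_on (sphere 0 1) (\<lambda>w. cnj (K w))"
    unfolding K_def by (intro continuous_intros) (use one_minus_cnj_mult_nonzero[OF z] in auto)
  have sa: "(\<lambda>j. a j * w ^ j) sums h w" if "cmod w < 1" for w
    unfolding a_def by (rule sums_analytic_disc[OF h(1) that])
  have a0: "a 0 = h 0" using sums_unique2[OF sa[of 0] powser_sums_zero[of a]] by simp
  \<comment> \<open>The conjugate of K carries the coefficients 2 z^j for j > 0 and 1 for j = 0, so
    the pairing doubles the Taylor series of h except at its constant term.\<close>
  have "mean_T (\<lambda>w. cnj (K w) * h w) = 2 * h z - h 0"
  proof -
    have "(\<lambda>j. c j * cnj (a j)) sums fourier_coeff (\<lambda>w. K w * cnj (h w)) 0"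
      using fourier_coeff_mult_sums[OF K L(2), of 0] by (simp add: fourier_coeff_cnj a_def)
    from sums_cnj[THEN iffD2, OF this]
    have 1: "(\<lambda>j. cnj (c j) * a j) sums cnj (fourier_coeff (\<lambda>w. K w * cnj (h w)) 0)" by simp
    have "(\<lambda>j. 2 * (a j * z ^ j) - (if j = 0 then a 0 else 0)) sums (2 * h z - a 0)"
      by (intro sums_diff sums_mult sa z sums_single[of 0 a, simplified] | use sums_single[of 0 "\<lambda>_. a 0"] in simp)+
    moreover have "(\<lambda>j. 2 * (a j * z ^ j) - (if j = 0 then a 0 else 0)) = (\<lambda>j. cnj (c j) * a j)"
      by (auto simp: c_def fun_eq_iff)
    ultimately have "cnj (fourier_coeff (\<lambda>w. K w * cnj (h w)) 0) = 2 * h z - a 0"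
      using sums_unique2[OF 1] by simp
    moreover have "cnj (fourier_coeff (\<lambda>w. K w * cnj (h w)) 0) = mean_T (\<lambda>w. cnj (K w) * h w)"
      by (simp add: fourier_coeff_mean flip: mean_T_cnj)
    ultimately show ?thesis using a0 by simp
  qed
  \<comment> \<open>Here K meets only the coefficients of h at frequencies -j, so only j = 0
    survives. As h(0) is real, this restores the constant term missing above.\<close>
  moreover have "mean_T (\<lambda>w. cnj (K w) * cnj (h w)) = cnj (h 0)"
  proof -
    have "(\<lambda>j. c j * fourier_coeff h (- int j)) sums fourier_coeff (\<lambda>w. K w * h w) 0"
      using fourier_coeff_mult_sums[OF K L(1), of 0] by simp
    moreover have "(\<lambda>j. c j * fourier_coeff h (- int j)) = (\<lambda>j. if j = 0 then h 0 else 0)"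
      using a0 by (auto simp: fun_eq_iff c_def a_def fourier_coeff_analytic_neg[OF h(1)])
    ultimately have "fourier_coeff (\<lambda>w. K w * h w) 0 = h 0"
      using sums_single[of 0 "\<lambda>_. h 0"] sums_unique2 by fastforce
    moreover have "cnj (fourier_coeff (\<lambda>w. K w * h w) 0) = mean_T (\<lambda>w. cnj (K w) * cnj (h w))"
      by (simp add: fourier_coeff_mean flip: mean_T_cnj)
    ultimately show ?thesis by simp
  qed
  moreover have "cnj (h 0) = h 0" using h(2) by (simp add: complex_eq_iff)
  ultimately have "mean_T (\<lambda>w. cnj (K w) * h w + cnj (K w) * cnj (h w)) = 2 * h z"
    by (subst mean_T_add) (intro L1_T_continuous_mult Kc L | simp)+
  moreover have "mean_T (\<lambda>w. cnj (K w) * h w + cnj (K w) * cnj (h w)) 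
      = mean_T (\<lambda>w. 2 * ((w + z) / (w - z) * of_real (u w)))"
  proof (rule mean_T_cong)
    fix w :: complex assume w: "cmod w = 1"
    then have nz: "w \<noteq> 0" "w - z \<noteq> 0" using z by auto
    have cw: "cnj w = 1 / w" using divide_conv_cnj[of w 1] w by simp
    have "cnj (K w) = (1 + z * (1 / w)) / (1 - z * (1 / w))"
      unfolding K_def complex_cnj_divide complex_cnj_add complex_cnj_diff complex_cnj_mult cw by simp
    also have "\<dots> = (w + z) / (w - z)" using nz by (simp add: field_simps)
    finally have "cnj (K w) = (w + z) / (w - z)" .
    moreover have "h w + cnj (h w) = 2 * of_real (u w)" by (simp add: u[OF w] complex_add_cnj)
    ultimately show "cnj (K w) * h w + cnj (K w) * cnj (h w) = 2 * ((w + z) / (w - z) * of_real (u w))"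
      by (simp only: distrib_left[symmetric]) simp
  qed
  ultimately have "mean_T (\<lambda>w. (w + z) / (w - z) * of_real (u w)) = h z"
    by (simp only: mean_T_cmult) simp
  then show ?thesis by (simp add: outer_fun_def mean_T_def)
qed

text \<open>Since \<open>h\<close> is continuous across the circle, the radial limit in
  \<open>boundary_val\<close> exists at every boundary point and equals exp(h). Its squared modulus
  is exp(2 Re h), which is J_0 because J_0 is positive on the circle.\<close>

lemma J_inv_sqrt_exp:
  assumes N: "N \<ge> 1" and zeros: "\<forall>j<N. \<alpha> j \<in> ball 0 1"
  obtains h where "h analytic_on cball 0 1"
    "\<And>z. cmod z = 1 \<Longrightarrow> J_inv_sqrt N (blaschke N \<alpha>) z = exp (- h z)"
    "\<And>z. cmod z = 1 \<Longrightarrow> J0 N (blaschke N \<alpha>) z = exp (h z) * cnj (exp (h z))"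
proof -
  obtain h where h: "h analytic_on cball 0 1" "Im (h 0) = 0"
    "\<And>z. cmod z = 1 \<Longrightarrow> ln (cmod (J0 N (blaschke N \<alpha>) z)) / 2 = Re (h z)"
    using half_ln_J0_harmonic[OF N zeros] by blast
  have "J_inv_sqrt N (blaschke N \<alpha>) z = exp (- h z)" if z: "cmod z = 1" for z
  proof -
    have "isCont h z" using h(1) z by (simp add: analytic_on_imp_differentiable_at field_differentiable_imp_continuous_at)
    moreover have "((\<lambda>r. of_real r * z) \<longlongrightarrow> of_real 1 * z) (at_left (1::real))"
      by (intro tendsto_intros)
    ultimately have "((\<lambda>r. exp (h (of_real r * z))) \<longlongrightarrow> exp (h z)) (at_left (1::real))"
      by (intro tendsto_exp) (use isCont_tendsto_compose in force)
    moreover have "eventually (\<lambda>r. exp (h (of_real r * z)) = J_sqrt N (blaschke N \<alpha>) (of_real r * z)) (at_left (1::real))"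
      using eventually_at_left_real[of 0 "1::real", simplified]
    proof eventually_elim
      case (elim r)
      then have "cmod (of_real r * z) < 1" using z by (simp add: norm_mult)
      from outer_fun_Re[OF h(1,2) h(3) this] show ?case unfolding J_sqrt_def by simp
    qed
    ultimately have "((\<lambda>r. J_sqrt N (blaschke N \<alpha>) (of_real r * z)) \<longlongrightarrow> exp (h z)) (at_left (1::real))"
      by (rule Lim_transform_eventually)
    then have "boundary_val (J_sqrt N (blaschke N \<alpha>)) z = exp (h z)"
      unfolding boundary_val_def by (intro tendsto_Lim) auto
    then show ?thesis by (simp add: J_inv_sqrt_def exp_minus)
  qed
  moreover have "J0 N (blaschke N \<alpha>) z = exp (h z) * cnj (exp (h z))" if z: "cmod z = 1" for z
  proof -
    have pos: "poisson_sum N \<alpha> z / N > 0" using poisson_sum_pos[OF zeros N z] N by simp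
    have "2 * Re (h z) = ln (poisson_sum N \<alpha> z / N)"
      using h(3)[OF z] poisson_sum_pos[OF zeros N z] unfolding J0_blaschke[OF zeros z] norm_of_real by simp
    then have "exp (2 * Re (h z)) = poisson_sum N \<alpha> z / N" using pos by simp
    moreover have "exp (h z) * cnj (exp (h z)) = of_real (exp (2 * Re (h z)))"
      by (simp add: exp_double complex_norm_square[symmetric])
    ultimately show ?thesis by (simp add: J0_blaschke[OF zeros z])
  qed
  ultimately show ?thesis using that h(1) by blast
qed

section \<open>The transfer operator\<close>

lemma absolutely_integrable_shift:
  fixes X :: "real \<Rightarrow> complex"
  shows "X absolutely_integrable_on {a+c..b+c} \<and> integral {a+c..b+c} X = I
     \<longleftrightarrow> (\<lambda>x. X (x + c)) absolutely_integrable_on {a..b} \<and> integral {a..b} (\<lambda>x. X (x + c)) = I"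
proof -
  have "(\<lambda>x. x + c) ` {a..b} = {a+c..b+c}" by (simp add: add.commute)
  moreover have "((\<lambda>x. x + c) has_field_derivative 1) (at x within {a..b})" for x
    by (auto intro!: derivative_eq_intros)
  ultimately show ?thesis
    using has_absolute_integral_change_of_variables_real[of "{a..b}" "\<lambda>x. x + c" "\<lambda>_. 1" X I]
    by (simp add: inj_on_def)
qed

lemma absolutely_integrable_combine_Icc:
  fixes X :: "real \<Rightarrow> complex"
  assumes "X absolutely_integrable_on {a..b}" "X absolutely_integrable_on {b..c}" "a \<le> b" "b \<le> c"
  shows "X absolutely_integrable_on {a..c} \<and> integral {a..c} X = integral {a..b} X + integral {b..c} X"
proof -
  have "{a..c} = {a..b} \<union> {b..c}" using assms by auto
  then have "X absolutely_integrable_on {a..c}" using absolutely_integrable_Un[OF assms(1,2)] by simp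
  then show ?thesis using assms(3,4) 
    by (auto intro!: Henstock_Kurzweil_Integration.integral_combine[symmetric] 
        dest: set_lebesgue_integral_eq_integral(1))
qed

lemma periodic_int:
  fixes X :: "real \<Rightarrow> complex"
  assumes "\<And>t. X (t + p) = X t"
  shows "X (t + of_int n * p) = X t"
proof -
  have nat: "X (t + real k * p) = X t" for k t
  proof (induction k)
    case (Suc k)
    have "t + real (Suc k) * p = (t + real k * p) + p" by (simp add: algebra_simps)
    then show ?case by (simp only: assms Suc)
  qed simp
  show ?thesis
  proof (cases "n \<ge> 0")
    case True
    then show ?thesis using nat[of t "nat n"] by simp
  next
    case False
    then show ?thesis using nat[of "t + of_int n * p" "nat (-n)"] by simp
  qed
qed

lemma absolutely_integrable_periodic:
  fixes X :: "real \<Rightarrow> complex"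
  assumes p: "p > 0" and per: "\<And>t. X (t + p) = X t" and X: "X absolutely_integrable_on {c..c+p}"
  shows "X absolutely_integrable_on {a..a+p} \<and> integral {a..a+p} X = integral {c..c+p} X"
proof -
  define n where "n = \<lfloor>(a - c) / p\<rfloor>"
  \<comment> \<open>\<open>r\<close> is the translate of \<open>a\<close> by whole periods into
    [c, c+p]. The piece [c, r], moved one period to the right, completes [r, c+p] to the full period
    [r, r+p].\<close>
  define r where "r = a - of_int n * p"
  have "of_int n \<le> (a - c) / p" "(a - c) / p < of_int n + 1" unfolding n_def by linarith+
  then have r: "c \<le> r" "r \<le> c + p" using p by (auto simp: r_def field_simps)
  have shift: "X absolutely_integrable_on {u + of_int k * p..v + of_int k * p} \<and> 
      integral {u + of_int k * p..v + of_int k * p} X = integral {u..v} X"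
    if "X absolutely_integrable_on {u..v}" for u v k
    unfolding absolutely_integrable_shift periodic_int[of X, OF per] using that by simp
  have 1: "X absolutely_integrable_on {r..c+p}" "X absolutely_integrable_on {c..r}"
    by (rule absolutely_integrable_on_subinterval[OF X]; use r in auto)+
  have "X absolutely_integrable_on {c + p..r + p}" "integral {c + p..r + p} X = integral {c..r} X"
    using shift[OF 1(2), of 1] by simp_all
  with absolutely_integrable_combine_Icc[OF 1(1), of "r + p"] absolutely_integrable_combine_Icc[OF 1(2,1) r] r
  have 2: "X absolutely_integrable_on {r..r+p}" "integral {r..r+p} X = integral {c..c+p} X" by simp_all
  have "r + of_int n * p = a" "r + p + of_int n * p = a + p" by (simp_all add: r_def)
  with shift[OF 2(1), of n] 2(2) show ?thesis by simp
qed

section \<open>Passing between the circle and the real line\<close>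

lemma L1_T_iff: "L1_T f \<longleftrightarrow> (\<lambda>t. f (cis t)) absolutely_integrable_on {0..2*pi}"
  unfolding L1_T_def on_circ_def circM_def set_integrable_def by (subst integrable_restrict_space) auto

lemma mean_T_integral: "L1_T f \<Longrightarrow> mean_T f = integral {0..2*pi} (\<lambda>t. f (cis t)) / of_real (2*pi)"
  unfolding mean_T_def L1_T_def on_circ_def circM_def by (subst lebesgue_integral_eq_integral) auto

lemma cis_add_2pi: "cis (t + 2 * pi) = cis t"
  by (simp add: complex_eq_iff)

lemma cis_add_2pi_int: "cis (t + 2 * pi * of_int n) = cis t"
  using periodic_int[of cis "2*pi" t n, OF cis_add_2pi] by (simp add: mult.commute)

lemma cis_eq_cis: "cis s = cis t \<longleftrightarrow> (\<exists>n::int. s = t + 2 * pi * of_int n)"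
  using sin_cos_eq_iff[of s t] by (auto simp: complex_eq_iff)

text \<open>Near a point w the angle s + Im Ln(z/w) is continuous, because z/w stays close to 1 and
  away from the cut; F is then locally the composition of the given function on the line with this
  angle.\<close>

lemma continuous_on_sphere_from_circ:
  fixes F :: "complex \<Rightarrow> complex"
  assumes "continuous_on UNIV (\<lambda>t. F (cis t))"
  shows "continuous_on (sphere 0 1) F"
  unfolding continuous_on_eq_continuous_within
proof
  fix w :: complex assume "w \<in> sphere 0 1"
  then have w: "cmod w = 1" "w \<noteq> 0" by auto
  define s where "s = Arg w"
  have ws: "w = cis s" using w unfolding s_def by (simp add: cis_Arg sgn_eq)
  define g where "g = (\<lambda>z. s + Im (Ln (z / w)))"
  have F: "F z = F (cis (g z))" if "z \<in> sphere 0 1" for z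
  proof -
    have z: "cmod z = 1" "z \<noteq> 0" using that by auto
    have "Re (Ln (z / w)) = 0" using z w by (subst Re_Ln) (auto simp: norm_divide)
    then have "exp (Ln (z / w)) = cis (Im (Ln (z / w)))" by (subst exp_eq_polar) simp
    moreover have "exp (Ln (z / w)) = z / w" using z w by (intro exp_Ln) simp
    ultimately have "cis (Im (Ln (z / w))) = z / w" by simp
    then have "cis (g z) = z" unfolding g_def cis_mult[symmetric] ws[symmetric] using w by simp
    then show ?thesis by simp
  qed
  have "continuous (at w) g" unfolding g_def using w by (intro continuous_intros) auto
  moreover have "isCont (\<lambda>t. F (cis t)) (g w)" 
    using assms by (simp add: continuous_on_eq_continuous_at)
  ultimately have "continuous (at w) (\<lambda>z. F (cis (g z)))"
    by (rule continuous_at_compose[unfolded o_def])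
  then have "continuous (at w within sphere 0 1) (\<lambda>z. F (cis (g z)))"
    by (rule continuous_at_imp_continuous_within)
  then show "continuous (at w within sphere 0 1) F"
  proof (rule continuous_transform_within[where \<delta>=1])
    show "F (cis (g z)) = F z" if "z \<in> sphere 0 1" for z by (rule F[OF that, symmetric])
  qed (use w in simp_all)
qed

section \<open>The angular lift of \<open>b\<close> and the parametrised fibres\<close>

locale blaschke_product =
  fixes N :: nat and \<alpha> :: "nat \<Rightarrow> complex"
  assumes N: "N \<ge> 1" and zeros: "\<forall>j<N. \<alpha> j \<in> ball 0 1"
begin

definition b where "b = blaschke N \<alpha>"

definition jac where "jac t = poisson_sum N \<alpha> (cis t)"

lemma jac_pos: "jac t > 0"
  by (simp add: jac_def poisson_sum_pos[OF zeros N])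

lemma continuous_jac: "continuous_on UNIV jac"
  unfolding jac_def[abs_def]
  by (rule continuous_on_compose2[OF continuous_poisson_sum[OF zeros]]) (auto intro: continuous_intros)

lemma DERIV_b_cis: "((\<lambda>t. b (cis t)) has_vector_derivative \<i> * of_real (jac t) * b (cis t)) (at t)"
proof -
  have "((\<lambda>z. b (exp (\<i> * z))) has_field_derivative 
      b (cis t) * of_real (jac t) / cis t * (exp (\<i> * of_real t) * \<i>)) (at (of_real t))"
    by (rule DERIV_chain2[where f = b and g = "\<lambda>z. exp (\<i> * z)"])
       (use DERIV_blaschke[OF zeros, of "cis t"] in \<open>auto intro!: derivative_eq_intros simp: b_def jac_def cis_conv_exp\<close>)
  from has_vector_derivative_real_field[OF this] show ?thesis
    by (simp add: cis_conv_exp[symmetric] mult_ac)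
qed

text \<open>\<open>\<theta>\<close> lifts \<open>b\<close> to the real line; its inverse \<open>\<tau>\<close> parametrises the fibres of \<open>b\<close>.\<close>

lemma lift_exists:
  "\<exists>\<theta>. (\<forall>t. (\<theta> has_real_derivative jac t) (at t)) \<and> (\<forall>t. b (cis t) = cis (\<theta> t))"
proof -
  have "isCont jac x" for x using continuous_jac by (simp add: continuous_on_eq_continuous_at)
  then obtain F where F: "\<And>t. (F has_vector_derivative jac t) (at t)"
    using einterval_antiderivative[of "-\<infinity>" "\<infinity>" jac] by auto
  \<comment> \<open>An antiderivative F of \<open>jac\<close> has the angular speed of b, so this
    product is constant; the constant is unimodular and its argument is absorbed into the
    lift.\<close>
  have "((\<lambda>t. b (cis t) * cis (- F t)) has_vector_derivative 0) (at t)" for t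
  proof -
    have "((\<lambda>t. cis (- F t)) has_vector_derivative (- jac t) *\<^sub>R (\<i> * cis (- F t))) (at t)"
    proof -
      have 1: "(cis has_vector_derivative \<i> * cis x) (at x within A)" for x A
      proof -
        have "((\<lambda>z. exp (\<i> * z)) has_field_derivative exp (\<i> * of_real x) * \<i>) (at (of_real x))"
          by (auto intro!: derivative_eq_intros)
        from has_vector_derivative_real_field[OF this] show ?thesis by (simp add: cis_conv_exp[abs_def] mult.commute)
      qed
      have 2: "((\<lambda>t. - F t) has_vector_derivative - jac t) (at t)" by (intro has_vector_derivative_minus F)
      show ?thesis using vector_diff_chain_within[OF 2 1] by (simp add: o_def)
    qed
    from has_vector_derivative_mult[OF DERIV_b_cis this] show ?thesis 
      by (simp add: scaleR_conv_of_real algebra_simps)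
  qed
  then obtain k where k: "\<And>t. b (cis t) * cis (- F t) = k"
    using has_vector_derivative_zero_constant[of UNIV "\<lambda>t. b (cis t) * cis (- F t)"] by auto
  have b: "b (cis t) = k * cis (F t)" for t
  proof -
    have "k * cis (F t) = b (cis t) * (cis (- F t) * cis (F t))" by (simp only: k[of t, symmetric] mult.assoc)
    then show ?thesis by (simp add: cis_mult)
  qed
  have "cmod (b (cis 0)) = 1" unfolding b_def by (rule norm_blaschke_circ[OF zeros]) simp
  then have "cmod k = 1" unfolding b by (simp add: norm_mult)
  then have "k = cis (Arg k)" by (subst cis_Arg) (auto simp: sgn_eq)
  then have "b (cis t) = cis (F t + Arg k)" for t
    unfolding b cis_mult[symmetric] by (simp add: mult.commute)
  moreover have "((\<lambda>t. F t + Arg k) has_real_derivative jac t) (at t)" for t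
    using F[of t] by (auto intro!: derivative_eq_intros simp: has_real_derivative_iff_has_vector_derivative)
  ultimately show ?thesis by (intro exI[of _ "\<lambda>t. F t + Arg k"]) auto
qed

definition \<theta> where "\<theta> = (SOME \<theta>. (\<forall>t. (\<theta> has_real_derivative jac t) (at t)) \<and> (\<forall>t. b (cis t) = cis (\<theta> t)))"

lemma DERIV_theta: "(\<theta> has_real_derivative jac t) (at t)" 
  and b_cis: "b (cis t) = cis (\<theta> t)"
  using someI_ex[OF lift_exists, folded \<theta>_def] by blast+

lemma theta_strict_mono: "strict_mono \<theta>"
proof (rule strict_monoI)
  fix s t :: real assume "s < t"
  then show "\<theta> s < \<theta> t" by (rule DERIV_pos_imp_increasing) (use DERIV_theta jac_pos in blast)
qed

text \<open>The winding number of \<open>b\<close> on the circle; it equals \<open>N\<close>, but only its positivity matters below.\<close>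

definition K where "K = nat \<lfloor>(\<theta> (2*pi) - \<theta> 0) / (2*pi)\<rfloor>"

text \<open>\<open>jac\<close> is 2 pi-periodic, so the increment of \<theta> over one turn is
  constant. It is a multiple of 2 pi because b(cis t) returns to its value, and positive because
  \<theta> increases.\<close>

lemma theta_2pi: "\<theta> (t + 2*pi) = \<theta> t + 2*pi*K" and K_pos: "K > 0"
proof -
  have "((\<lambda>t. \<theta> (t + 2*pi) - \<theta> t) has_real_derivative 0) (at t)" for t
  proof -
    have "((\<lambda>t. \<theta> (t + 2*pi)) has_real_derivative jac (t + 2*pi)) (at t)"
      using DERIV_theta[of "t + 2*pi"] by (simp add: DERIV_shift)
    from DERIV_diff[OF this DERIV_theta] show ?thesis by (simp add: jac_def cis_add_2pi)
  qed
  then have const: "\<theta> (t + 2*pi) - \<theta> t = \<theta> (0 + 2*pi) - \<theta> 0" for t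
    using DERIV_isconst_all[of "\<lambda>t. \<theta> (t + 2*pi) - \<theta> t"] by blast
  have "cis (\<theta> (2*pi)) = cis (\<theta> 0)" using b_cis[of "2*pi"] b_cis[of 0] by simp
  then obtain n where n: "\<theta> (2*pi) = \<theta> 0 + 2*pi* of_int n" unfolding cis_eq_cis by blast
  have "\<theta> 0 < \<theta> (2*pi)" using theta_strict_mono by (simp add: strict_mono_less)
  then have "n > 0" using n by (simp add: zero_less_mult_iff)
  moreover have "K = nat n" unfolding K_def n by simp
  ultimately show "K > 0" "\<theta> (t + 2*pi) = \<theta> t + 2*pi*K" using const[of t] n by auto
qed

lemma theta_2pi_int: "\<theta> (t + 2*pi* of_int n) = \<theta> t + 2*pi*K* of_int n"
proof -
  have "complex_of_real (\<theta> (t + of_int n * (2*pi)) - K * (t + of_int n * (2*pi))) = of_real (\<theta> t - K * t)"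
    by (rule periodic_int[of "\<lambda>t. complex_of_real (\<theta> t - K * t)"]) (simp only: theta_2pi, simp add: algebra_simps)
  then have "\<theta> (t + of_int n * (2*pi)) - K * (t + of_int n * (2*pi)) = \<theta> t - K * t"
    by (simp only: of_real_eq_iff)
  then show ?thesis by (simp add: algebra_simps)
qed

lemma theta_surj: "\<exists>t. \<theta> t = s"
proof -
  define n where "n = \<lceil>\<bar>s - \<theta> 0\<bar>\<rceil>"
  have n: "\<bar>s - \<theta> 0\<bar> \<le> of_int n" by (simp add: n_def)
  then have n0: "(0::real) \<le> of_int n" using abs_ge_zero[of "s - \<theta> 0"] by linarith
  define M where "M = 2*pi*K* of_int n"
  \<comment> \<open>After n turns \<theta> has moved by 2 pi K n, which is at least n; hence n turns
    in either direction pass \<open>s\<close> and the intermediate value theorem applies.\<close>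
  have "1 * 1 \<le> (2*pi) * real K" using pi_gt3 K_pos by (intro mult_mono) auto
  from mult_right_mono[OF this n0] have M: "of_int n \<le> M" by (simp add: M_def)
  define a where "a = 2*pi* of_int n"
  have \<theta>a: "\<theta> a = \<theta> 0 + M" "\<theta> (- a) = \<theta> 0 - M"
    using theta_2pi_int[of 0 n] theta_2pi_int[of 0 "- n"] by (simp_all add: a_def M_def)
  have "continuous_on {- a..a} \<theta>"
    by (intro continuous_at_imp_continuous_on ballI DERIV_isCont[OF DERIV_theta])
  moreover have "\<theta> (- a) \<le> s" "s \<le> \<theta> a" unfolding \<theta>a using n M by linarith+
  moreover have "- a \<le> a" using n0 by (simp add: a_def)
  ultimately show ?thesis using IVT'[of \<theta> "- a" s a] by blast
qed

definition \<tau> where "\<tau> = inv \<theta>"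

lemma theta_tau [simp]: "\<theta> (\<tau> s) = s"
proof -
  have "surj \<theta>" by (rule surjI[of _ "\<lambda>s. SOME t. \<theta> t = s"]) (rule someI_ex[OF theta_surj])
  then show ?thesis unfolding \<tau>_def by (rule surj_f_inv_f)
qed

lemma tau_theta [simp]: "\<tau> (\<theta> t) = t"
  unfolding \<tau>_def by (simp add: strict_mono_imp_inj_on[OF theta_strict_mono])

lemma continuous_tau: "continuous_on UNIV \<tau>"
proof -
  have "isCont \<tau> (\<theta> t)" for t
    by (rule isCont_inverse_function[of 1]) (auto intro: DERIV_isCont[OF DERIV_theta])
  from this[of "\<tau> s" for s] have "isCont \<tau> s" for s by simp
  then show ?thesis by (simp add: continuous_at_imp_continuous_on)
qed

lemma tau_shift: "\<tau> (s + 2*pi*K* of_int n) = \<tau> s + 2*pi* of_int n"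
proof -
  have "\<tau> s + 2*pi* of_int n = \<tau> (\<theta> (\<tau> s + 2*pi* of_int n))" by simp
  then show ?thesis by (simp only: theta_2pi_int theta_tau)
qed

text \<open>A point cis t lies over cis s exactly when \<theta> t = s + 2 pi m for an integer m.
  Raising m by K moves t by a full turn, so only the residue of m modulo K matters.\<close>

lemma fiber_b:
  "{w. cmod w = 1 \<and> b w = cis s} = (\<lambda>j. cis (\<tau> (s + 2*pi*real j))) ` {..<K}"
proof (intro equalityI subsetI)
  fix w assume "w \<in> {w. cmod w = 1 \<and> b w = cis s}"
  then have w: "cmod w = 1" "b w = cis s" by auto
  define t where "t = Arg w"
  have wt: "w = cis t" unfolding t_def using w by (subst cis_Arg) (auto simp: sgn_eq)
  have "cis (\<theta> t) = cis s" using w(2) unfolding wt b_cis .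
  then obtain m where m: "\<theta> t = s + 2*pi* of_int m" unfolding cis_eq_cis by blast
  define j where "j = nat (m mod int K)"
  have "int j = m mod int K" using K_pos by (simp add: j_def)
  then have j: "j < K" and m': "m = int j + int K * (m div int K)" 
    using K_pos by (auto simp: j_def nat_less_iff)
  have "t = \<tau> (s + 2*pi* of_int m)" by (simp flip: m)
  also have "s + 2*pi* of_int m = (s + 2*pi*real j) + 2*pi*K* of_int (m div int K)"
    by (subst m') (simp add: algebra_simps)
  finally have "t = \<tau> (s + 2*pi*real j) + 2*pi* of_int (m div int K)" unfolding tau_shift .
  then have "w = cis (\<tau> (s + 2*pi*real j))" unfolding wt by (simp only: cis_add_2pi_int)
  then show "w \<in> (\<lambda>j. cis (\<tau> (s + 2*pi*real j))) ` {..<K}" using j by blast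
next
  fix w assume "w \<in> (\<lambda>j. cis (\<tau> (s + 2*pi*real j))) ` {..<K}"
  moreover have "cis (s + 2*pi*real j) = cis s" for j using cis_add_2pi_int[of s "int j"] by simp
  ultimately show "w \<in> {w. cmod w = 1 \<and> b w = cis s}" by (auto simp: b_cis)
qed

lemma fiber_inj: "inj_on (\<lambda>j. cis (\<tau> (s + 2*pi*real j))) {..<K}"
proof (rule inj_onI)
  fix i j assume ij: "i \<in> {..<K}" "j \<in> {..<K}" "cis (\<tau> (s + 2*pi*real i)) = cis (\<tau> (s + 2*pi*real j))"
  then obtain n where "\<tau> (s + 2*pi*real i) = \<tau> (s + 2*pi*real j) + 2*pi* of_int n"
    unfolding cis_eq_cis by blast
  then have "\<theta> (\<tau> (s + 2*pi*real i)) = \<theta> (\<tau> (s + 2*pi*real j) + 2*pi* of_int n)" by simp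
  then have "s + 2*pi*real i = \<theta> (\<tau> (s + 2*pi*real j) + 2*pi* of_int n)" by simp
  also have "\<dots> = s + 2*pi*(real j + K * of_int n)" by (simp only: theta_2pi_int theta_tau) (simp add: algebra_simps)
  finally have "real i = real j + K * of_int n" by simp
  then have "real_of_int (int i) = real_of_int (int j + int K * n)" by simp
  then have "int i = int j + int K * n" by (simp only: of_int_eq_iff)
  then have "int i mod int K = int j mod int K" by simp
  then show "i = j" using ij by simp
qed

lemma transfer_cis: "transfer N b \<xi> (cis s) = (\<Sum>j<K. \<xi> (cis (\<tau> (s + 2*pi*real j)))) / of_nat N"
  unfolding transfer_def fiber_b by (subst sum.reindex[OF fiber_inj]) simp

text \<open>Along a fibre g(b w) has the constant value g z. This is the module identity L(\<xi>
  \<beta>(g)) = L(\<xi>) g.\<close>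

lemma transfer_mult_b: 
  "cmod z = 1 \<Longrightarrow> transfer N b (\<lambda>w. \<xi> w * g (b w)) z = transfer N b \<xi> z * g z"
  by (simp add: transfer_def sum_distrib_right)

end

section \<open>Change of variables and regularity of the transfer operator\<close>

context blaschke_product
begin

text \<open>The substitution s = \<theta> t carries one turn of the circle bijectively onto an
  interval of K turns.\<close>

lemma absolutely_integrable_lift:
  fixes Y :: "real \<Rightarrow> complex"
  assumes "(\<lambda>t. of_real (jac t) * Y (\<theta> t)) absolutely_integrable_on {0..2*pi}"
  shows "Y absolutely_integrable_on {\<theta> 0..\<theta> 0 + 2*pi*K} \<and>
         integral {\<theta> 0..\<theta> 0 + 2*pi*K} Y = integral {0..2*pi} (\<lambda>t. of_real (jac t) * Y (\<theta> t))"
proof -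
  have img: "\<theta> ` {0..2*pi} = {\<theta> 0..\<theta> 0 + 2*pi*K}"
  proof (intro equalityI subsetI)
    fix s assume s: "s \<in> {\<theta> 0..\<theta> 0 + 2*pi*K}"
    then have "\<tau> s \<in> {0..2*pi}" 
      using theta_2pi[of 0] strict_mono_less_eq[OF theta_strict_mono, of 0 "\<tau> s"] 
        strict_mono_less_eq[OF theta_strict_mono, of "\<tau> s" "2*pi"] by simp
    then show "s \<in> \<theta> ` {0..2*pi}" by (metis image_eqI theta_tau)
  next
    fix s assume "s \<in> \<theta> ` {0..2*pi}"
    then obtain t where t: "s = \<theta> t" "0 \<le> t" "t \<le> 0 + 2*pi" by auto
    then have "\<theta> 0 \<le> \<theta> t" "\<theta> t \<le> \<theta> (0 + 2*pi)" using theta_strict_mono by (simp_all add: strict_mono_less_eq)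
    then show "s \<in> {\<theta> 0..\<theta> 0 + 2*pi*K}" unfolding theta_2pi t(1) by simp
  qed
  have eq: "(\<lambda>t. \<bar>jac t\<bar> *\<^sub>R Y (\<theta> t)) = (\<lambda>t. of_real (jac t) * Y (\<theta> t))"
    using jac_pos by (auto simp: fun_eq_iff scaleR_conv_of_real less_imp_le)
  have "inj_on \<theta> {0..2*pi}"
    using strict_mono_imp_inj_on[OF theta_strict_mono] subset_UNIV by (rule inj_on_subset)
  then show ?thesis
    using has_absolute_integral_change_of_variables_real[of "{0..2*pi}" \<theta> jac Y 
        "integral {0..2*pi} (\<lambda>t. of_real (jac t) * Y (\<theta> t))"] assms
    unfolding img eq 
    by (simp add: DERIV_theta has_field_derivative_at_within)
qed

lemma J0_b: "cmod z = 1 \<Longrightarrow> J0 N b z = of_real (poisson_sum N \<alpha> z / N)"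
  unfolding b_def by (rule J0_blaschke[OF zeros])

lemma continuous_J0: "continuous_on (sphere 0 1) (J0 N b)"
proof -
  have "continuous_on (sphere 0 1) (\<lambda>z. complex_of_real (poisson_sum N \<alpha> z / N))"
    using N by (intro continuous_intros continuous_poisson_sum[OF zeros]) auto
  then show ?thesis by (rule continuous_on_eq) (simp add: J0_b)
qed

text \<open>The K sheets over one turn, laid end to end, fill the interval from \<theta> 0 to
  \<theta> 0 + 2 pi K, and the substitution by \<theta> folds this back to one turn with weight
  \<open>jac\<close>. The factor 1/N of the transfer operator makes that weight J_0.\<close>

lemma L1_T_transfer_mean:
  assumes "L1_T \<xi>"
  shows "L1_T (transfer N b \<xi>) \<and> mean_T (transfer N b \<xi>) = mean_T (\<lambda>z. J0 N b z * \<xi> z)"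
proof -
  define Y where "Y = (\<lambda>s. \<xi> (cis (\<tau> s)) / of_nat N)"
  have J\<xi>: "L1_T (\<lambda>z. J0 N b z * \<xi> z)" by (rule L1_T_continuous_mult[OF continuous_J0 assms])
  have eq: "of_real (jac t) * Y (\<theta> t) = J0 N b (cis t) * \<xi> (cis t)" for t
    by (simp add: Y_def J0_b jac_def)
  have lift: "Y absolutely_integrable_on {\<theta> 0..\<theta> 0 + 2*pi*K}"
         "integral {\<theta> 0..\<theta> 0 + 2*pi*K} Y = integral {0..2*pi} (\<lambda>t. J0 N b (cis t) * \<xi> (cis t))"
    using absolutely_integrable_lift[of Y, unfolded eq] J\<xi> by (auto simp: L1_T_iff)
  have Z: "(\<lambda>s. transfer N b \<xi> (cis s)) = (\<lambda>s. \<Sum>j<K. Y (s + 2*pi*real j))"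
    by (simp add: transfer_cis Y_def sum_divide_distrib fun_eq_iff)
  have piece: "(\<lambda>s. Y (s + 2*pi*real j)) absolutely_integrable_on {\<theta> 0..\<theta> 0 + 2*pi} \<and>
      integral {\<theta> 0..\<theta> 0 + 2*pi} (\<lambda>s. Y (s + 2*pi*real j)) 
        = integral {\<theta> 0 + 2*pi*real j..\<theta> 0 + 2*pi*real (Suc j)} Y" if "j < K" for j
  proof -
    have "real (Suc j) \<le> real K" using that by linarith
    then have "2*pi*real (Suc j) \<le> 2*pi*real K" by (intro mult_left_mono) auto
    then have "Y absolutely_integrable_on {\<theta> 0 + 2*pi*real j..(\<theta> 0 + 2*pi) + 2*pi*real j}"
      by (intro absolutely_integrable_on_subinterval[OF lift(1)]) (auto simp: algebra_simps intro: order_trans[rotated])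
    moreover have "\<theta> 0 + 2*pi*real (Suc j) = (\<theta> 0 + 2*pi) + 2*pi*real j" by (simp add: algebra_simps)
    ultimately show ?thesis
      by (simp only: absolutely_integrable_shift[where X=Y, symmetric])
  qed
  have parts: "k \<le> K \<Longrightarrow> integral {\<theta> 0..\<theta> 0 + 2*pi*real k} Y
      = (\<Sum>j<k. integral {\<theta> 0 + 2*pi*real j..\<theta> 0 + 2*pi*real (Suc j)} Y)" for k
  proof (induction k)
    case (Suc k)
    have "2*pi*real (Suc k) \<le> 2*pi*real K" using Suc.prems by (intro mult_left_mono) auto
    then have "Y absolutely_integrable_on {\<theta> 0..\<theta> 0 + 2*pi*real (Suc k)}"
      by (intro absolutely_integrable_on_subinterval[OF lift(1)]) auto
    then have i: "Y integrable_on {\<theta> 0..\<theta> 0 + 2*pi*real (Suc k)}" 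
      by (rule set_lebesgue_integral_eq_integral(1))
    have le: "2*pi*real k \<le> 2*pi*real (Suc k)" by (intro mult_left_mono) auto
    have "integral {\<theta> 0..\<theta> 0 + 2*pi*real (Suc k)} Y = integral {\<theta> 0..\<theta> 0 + 2*pi*real k} Y 
        + integral {\<theta> 0 + 2*pi*real k..\<theta> 0 + 2*pi*real (Suc k)} Y"
      by (rule Henstock_Kurzweil_Integration.integral_combine[OF _ _ i, symmetric]) (use le in auto)
    then show ?case using Suc by simp
  qed simp
  have "(\<lambda>s. transfer N b \<xi> (cis s)) absolutely_integrable_on {\<theta> 0..\<theta> 0 + 2*pi}"
    unfolding Z by (intro absolutely_integrable_sum) (use piece in auto)
  \<comment> \<open>The sheets are based at \<theta> 0, whereas means are taken over [0, 2 pi]; the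
    fibre sum is periodic, so the base point may be moved.\<close>
  from absolutely_integrable_periodic[OF _ _ this, of 0]
  have per: "(\<lambda>s. transfer N b \<xi> (cis s)) absolutely_integrable_on {0..2*pi}"
    "integral {0..2*pi} (\<lambda>s. transfer N b \<xi> (cis s)) = integral {\<theta> 0..\<theta> 0 + 2*pi} (\<lambda>s. transfer N b \<xi> (cis s))"
    by (simp_all add: cis_add_2pi)
  have "integral {\<theta> 0..\<theta> 0 + 2*pi} (\<lambda>s. transfer N b \<xi> (cis s)) 
      = (\<Sum>j<K. integral {\<theta> 0..\<theta> 0 + 2*pi} (\<lambda>s. Y (s + 2*pi*real j)))"
    unfolding Z by (intro integral_sum) (use piece in \<open>auto dest: set_lebesgue_integral_eq_integral(1)\<close>)
  also have "\<dots> = (\<Sum>j<K. integral {\<theta> 0 + 2*pi*real j..\<theta> 0 + 2*pi*real (Suc j)} Y)"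
    by (intro sum.cong) (use piece in auto)
  also have "\<dots> = integral {0..2*pi} (\<lambda>t. J0 N b (cis t) * \<xi> (cis t))"
    using parts[of K] lift(2) by simp
  finally show ?thesis using per J\<xi> by (simp add: mean_T_integral L1_T_iff)
qed

lemmas L1_T_transfer = L1_T_transfer_mean[THEN conjunct1]
  and mean_T_transfer = L1_T_transfer_mean[THEN conjunct2]

lemma norm_b_circ: "cmod z = 1 \<Longrightarrow> cmod (b z) = 1"
  unfolding b_def by (rule norm_blaschke_circ[OF zeros])

lemma continuous_b: "continuous_on (sphere 0 1) b"
  unfolding b_def by (intro analytic_circ_continuous analytic_blaschke zeros)

text \<open>The module identity moves z^(-n) inside as b^(-n) before the mean formula is
  applied.\<close>

lemma fourier_coeff_transfer:
  assumes "L1_T \<xi>"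
  shows "fourier_coeff (transfer N b \<xi>) n = mean_T (\<lambda>z. J0 N b z * (\<xi> z * b z powi (- n)))"
proof -
  have "continuous_on (sphere 0 1) (\<lambda>z. b z powi (- n))"
    by (intro continuous_intros continuous_b) (use norm_b_circ in force)
  from L1_T_continuous_mult[OF this assms] have L: "L1_T (\<lambda>z. \<xi> z * b z powi (- n))" 
    by (simp add: mult.commute)
  have "fourier_coeff (transfer N b \<xi>) n = mean_T (transfer N b (\<lambda>z. \<xi> z * b z powi (- n)))"
    unfolding fourier_coeff_mean by (intro mean_T_cong) (simp only: transfer_mult_b[where g="\<lambda>z. z powi - n"])
  then show ?thesis by (simp only: mean_T_transfer[OF L])
qed

text \<open>The transfer of |f| is nonnegative with mean equal to that of J_0 |f|, hence 0; so it
  vanishes almost everywhere, and it dominates the transfer of f. This makes \<open>transfer\<close>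
  well defined on classes.\<close>

lemma transfer_ae_zero:
  assumes "L1_T f" "ae_eq_T f (\<lambda>_. 0)"
  shows "ae_eq_T (transfer N b f) (\<lambda>_. 0)"
proof -
  define d where "d = (\<lambda>z. complex_of_real (cmod (f z)))"
  have d: "L1_T d" using assms(1) by (simp add: L1_T_def on_circ_def d_def)
  have "ae_eq_T (\<lambda>z. J0 N b z * d z) (\<lambda>_. 0)"
    using assms(2) unfolding ae_eq_T_def by eventually_elim (simp add: d_def)
  moreover have "L1_T (\<lambda>z. J0 N b z * d z)" by (rule L1_T_continuous_mult[OF continuous_J0 d])
  ultimately have "mean_T (\<lambda>z. J0 N b z * d z) = mean_T (\<lambda>_. 0)"
    by (intro mean_T_ae) (auto simp: L1_T_def)
  then have "mean_T (\<lambda>z. J0 N b z * d z) = 0" by (simp add: mean_T_def)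
  then have 0: "mean_T (transfer N b d) = 0" by (simp only: mean_T_transfer[OF d])
  define D where "D = (\<lambda>z. (\<Sum>w\<in>{w. cmod w = 1 \<and> b w = z}. cmod (f w)) / N)"
  have D: "transfer N b d z = of_real (D z)" for z
    by (simp add: transfer_def D_def d_def)
  have "integrable circM (\<lambda>t. complex_of_real (D (cis t)))"
    using L1_T_transfer[OF d] by (simp add: L1_T_def on_circ_def D)
  then have "integrable circM (\<lambda>t. D (cis t))" using integrable_Re by fastforce
  moreover have "integral\<^sup>L circM (\<lambda>t. D (cis t)) = 0" using 0 by (simp add: mean_T_def D)
  moreover have nn: "D z \<ge> 0" for z unfolding D_def by (intro divide_nonneg_nonneg sum_nonneg) auto
  ultimately have "AE t in circM. D (cis t) = 0"
    using integral_nonneg_eq_0_iff_AE[of circM "\<lambda>t. D (cis t)"] by simp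
  then show ?thesis unfolding ae_eq_T_def
  proof eventually_elim
    case (elim t)
    have "cmod (transfer N b f (cis t)) \<le> D (cis t)"
      unfolding transfer_def D_def norm_divide by (simp add: divide_right_mono norm_sum)
    then show ?case using elim by simp
  qed
qed

lemma transfer_diff: "transfer N b (\<lambda>w. f w - g w) z = transfer N b f z - transfer N b g z"
  by (simp add: transfer_def sum_subtractf diff_divide_distrib)

lemma transfer_ae:
  assumes "L1_T f" "ae_eq_T f g"
  shows "ae_eq_T (transfer N b f) (transfer N b g)"
proof -
  have g: "L1_T g" by (rule L1_T_ae[OF assms(2,1)])
  have "ae_eq_T (\<lambda>z. f z - g z) (\<lambda>_. 0)" using assms(2) unfolding ae_eq_T_def by eventually_elim simp
  from transfer_ae_zero[OF L1_T_diff[OF assms(1) g] this] show ?thesis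
    unfolding ae_eq_T_def transfer_diff by simp
qed

lemma Linf_T_transfer:
  assumes "Linf_T f" shows "Linf_T (transfer N b f)"
proof -
  obtain C where C: "AE t in circM. cmod (f (cis t)) \<le> C" using assms by (auto simp: Linf_T_def)
  \<comment> \<open>A representative bounded at every point is required, since a fibre sum could
    otherwise meet the exceptional null set.\<close>
  define f1 where "f1 = (\<lambda>z. if cmod (f z) \<le> C then f z else 0)"
  have ae: "ae_eq_T f f1" unfolding ae_eq_T_def using C by eventually_elim (simp add: f1_def)
  have L: "L1_T f" by (rule Linf_T_L1[OF assms])
  have "cmod (transfer N b f1 (cis t)) \<le> (\<Sum>j<K. \<bar>C\<bar>) / N" for t
    unfolding transfer_cis norm_divide norm_of_nat
    by (intro divide_right_mono sum_norm_le) (auto simp: f1_def)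
  then have "\<exists>C. AE t in circM. cmod (transfer N b f1 (cis t)) \<le> C" by (intro exI AE_I2) auto
  moreover have "L1_T (transfer N b f1)" by (rule L1_T_transfer[OF L1_T_ae[OF ae L]])
  ultimately have "Linf_T (transfer N b f1)" by (auto simp: Linf_T_def L1_T_def)
  then show ?thesis using Linf_T_ae_eq ae_eq_T_sym transfer_ae[OF L ae] by blast
qed

text \<open>On the line every sheet is continuous. Adding 2 pi to the angle permutes the sheets
  cyclically, so it is their sum that descends to the circle.\<close>

lemma continuous_transfer:
  assumes "continuous_on (sphere 0 1) f"
  shows "continuous_on (sphere 0 1) (transfer N b f)"
proof (rule continuous_on_sphere_from_circ)
  have "continuous_on UNIV (\<lambda>s. f (cis (\<tau> (s + 2*pi*real j))))" for j
    by (rule continuous_on_compose2[OF assms]) (auto intro!: continuous_intros continuous_on_compose2[OF continuous_tau])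
  then show "continuous_on UNIV (\<lambda>s. transfer N b f (cis s))"
    unfolding transfer_cis using N by (intro continuous_intros) auto
qed

end

section \<open>Hardy spaces and the model space\<close>

definition H1_T :: "(complex \<Rightarrow> complex) \<Rightarrow> bool" where
  "H1_T g \<longleftrightarrow> L1_T g \<and> (\<forall>n<0. fourier_coeff g n = 0)"

text \<open>For n < 0 the Cauchy product only involves coefficients of g at n - j with j
  nonnegative, all of them negative frequencies.\<close>

lemma H1_T_analytic_mult:
  assumes "\<phi> analytic_on cball 0 1" "H1_T g"
  shows "H1_T (\<lambda>z. \<phi> z * g z)"
proof -
  have g: "L1_T g" and z: "\<And>n. n < 0 \<Longrightarrow> fourier_coeff g n = 0" using assms(2) by (auto simp: H1_T_def)
  have "fourier_coeff (\<lambda>z. \<phi> z * g z) n = 0" if "n < 0" for n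
  proof -
    have "fourier_coeff g (n - int j) = 0" for j using that by (intro z) simp
    then have "(\<lambda>_. 0) sums fourier_coeff (\<lambda>z. \<phi> z * g z) n"
      using fourier_coeff_mult_sums[OF boundary_series_analytic[OF assms(1)] g, of n] by simp
    then show ?thesis by (rule sums_unique2[OF _ sums_zero])
  qed
  then show ?thesis using L1_T_continuous_mult[OF analytic_circ_continuous[OF assms(1)] g] by (simp add: H1_T_def)
qed

lemma H2_T_H1: "H2_T g \<Longrightarrow> H1_T g"
  by (auto simp: H2_T_def H1_T_def L2_T_L1)

lemma Hinf_T_H2: "Hinf_T g \<Longrightarrow> H2_T g"
  by (auto simp: H2_T_def Hinf_T_def Linf_T_L2)

lemma H2_T_analytic_mult:
  assumes "\<phi> analytic_on cball 0 1" "H2_T g"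
  shows "H2_T (\<lambda>z. \<phi> z * g z)"
proof -
  have "L2_T g" using assms(2) by (simp add: H2_T_def)
  then have "L2_T (\<lambda>z. \<phi> z * g z)"
    by (rule L2_T_Linf_mult[OF Linf_T_continuous[OF analytic_circ_continuous[OF assms(1)]]])
  moreover have "H1_T (\<lambda>z. \<phi> z * g z)" by (rule H1_T_analytic_mult[OF assms(1) H2_T_H1[OF assms(2)]])
  ultimately show ?thesis by (simp add: H2_T_def H1_T_def)
qed

lemma H2_T_analytic: "\<phi> analytic_on cball 0 1 \<Longrightarrow> H2_T \<phi>"
  by (simp add: H2_T_def Linf_T_L2 Linf_T_continuous analytic_circ_continuous fourier_coeff_analytic_neg)

lemma norm_fourier_coeff_le:
  assumes "L1_T g" "\<And>z. cmod z = 1 \<Longrightarrow> cmod (f z) \<le> cmod (g z)"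
  shows "cmod (fourier_coeff f n) \<le> cmod (mean_T (\<lambda>z. of_real (cmod (g z))))"
proof -
  have "cmod (f z * z powi (- n)) \<le> 1 * cmod (g z)" if "cmod z = 1" for z
    using assms(2)[OF that] that by (simp add: norm_mult norm_power_int)
  from norm_mean_T_le[OF assms(1) this] show ?thesis unfolding fourier_coeff_mean by simp
qed

section \<open>Powers of \<open>b\<close> and the structure of the model space\<close>

context blaschke_product
begin

lemma analytic_b: "b analytic_on cball 0 1"
  unfolding b_def by (rule analytic_blaschke[OF zeros])

lemma analytic_b_power: "(\<lambda>z. b z ^ k) analytic_on cball 0 1"
  by (intro analytic_on_power analytic_b)

lemma b_cnj_b: "cmod z = 1 \<Longrightarrow> b z * cnj (b z) = 1"
  using complex_norm_square[of "b z"] norm_b_circ[of z] by simp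

text \<open>On the disc of radius 1/2 the maximum \<rho> of |b| is below 1, and Cauchy's estimate
  bounds the j-th Taylor coefficient of b^k by 2^j \<rho>^k.\<close>

lemma fourier_coeff_b_power_tendsto_0: "(\<lambda>k. fourier_coeff (\<lambda>z. b z ^ k) n) \<longlonglongrightarrow> 0"
proof (cases "n \<ge> 0")
  case False
  then show ?thesis by (simp add: fourier_coeff_analytic_neg[OF analytic_b_power])
next
  case True
  define j where "j = nat n"
  have hol: "(\<lambda>z. b z ^ k) holomorphic_on ball 0 1" for k
    using analytic_b_power analytic_imp_holomorphic holomorphic_on_subset ball_subset_cball by blast
  have cont: "continuous_on (cball 0 (1/2)) b"
    by (rule continuous_on_subset[OF holomorphic_on_imp_continuous_on[OF analytic_imp_holomorphic[OF analytic_b]]]) auto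
  obtain w where w: "w \<in> cball 0 (1/2)" "\<And>z. z \<in> cball 0 (1/2) \<Longrightarrow> cmod (b z) \<le> cmod (b w)"
    using continuous_attains_sup[of "cball 0 (1/2)" "\<lambda>z. cmod (b z)"] continuous_on_norm[OF cont] by auto
  define \<rho> where "\<rho> = cmod (b w)"
  have \<rho>: "\<rho> < 1" "\<rho> \<ge> 0" 
  proof -
    have "cmod w < 1" using w(1) by simp
    then show "\<rho> < 1" unfolding \<rho>_def b_def by (rule norm_blaschke_disc[OF zeros N])
  qed (simp add: \<rho>_def)
  have bound: "cmod (fourier_coeff (\<lambda>z. b z ^ k) n) \<le> 2 ^ j * \<rho> ^ k" for k
  proof -
    have "cmod ((deriv ^^ j) (\<lambda>z. b z ^ k) 0) \<le> fact j * \<rho> ^ k / (1/2) ^ j"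
    proof (rule Cauchy_inequality)
      show "(\<lambda>z. b z ^ k) holomorphic_on ball 0 (1/2)" by (rule holomorphic_on_subset[OF hol]) auto
      show "continuous_on (cball 0 (1/2)) (\<lambda>z. b z ^ k)" by (intro continuous_on_power cont)
      show "cmod (b z ^ k) \<le> \<rho> ^ k" if "cmod (0 - z) = 1/2" for z
        unfolding norm_power using that w(2)[of z] by (intro power_mono) (auto simp: \<rho>_def)
    qed simp
    also have "fact j * \<rho> ^ k / (1/2) ^ j = 2 ^ j * \<rho> ^ k * fact j" by (simp add: power_divide)
    finally have "cmod ((deriv ^^ j) (\<lambda>z. b z ^ k) 0) / fact j \<le> 2 ^ j * \<rho> ^ k"
      by (subst pos_divide_le_eq) auto
    moreover have "fourier_coeff (\<lambda>z. b z ^ k) n = (deriv ^^ j) (\<lambda>z. b z ^ k) 0 / fact j"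
      using fourier_coeff_boundary_series[OF boundary_series_analytic[OF analytic_b_power], of k n] True 
      unfolding j_def by simp
    ultimately show ?thesis by (simp only: norm_divide norm_fact)
  qed
  have "(\<lambda>k. 2 ^ j * \<rho> ^ k) \<longlonglongrightarrow> 2 ^ j * 0"
    by (intro tendsto_intros LIMSEQ_realpow_zero \<rho>)
  then have "(\<lambda>k. 2 ^ j * \<rho> ^ k) \<longlonglongrightarrow> 0" by simp
  then show ?thesis 
    by (rule Lim_null_comparison[rotated]) (intro always_eventually allI bound)
qed

lemma model_space_orthogonal:
  assumes "d \<in> model_space b" "H2_T g" shows "mean_T (\<lambda>z. cnj (b z * g z) * d z) = 0"
  using assms by (auto simp: model_space_def inner_L2_mean)

lemma model_space_orthogonal':
  assumes "d \<in> model_space b" "H2_T g" shows "mean_T (\<lambda>z. cnj (d z) * (b z * g z)) = 0"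
proof -
  have "mean_T (\<lambda>z. cnj (d z) * (b z * g z)) = cnj (mean_T (\<lambda>z. cnj (b z * g z) * d z))"
    unfolding mean_T_cnj[symmetric] by (intro mean_T_cong) simp
  then show ?thesis using model_space_orthogonal[OF assms] by simp
qed

text \<open>With q the denominator of b, the product q d has no frequency below 0, because d and q
  are analytic, and none from N upwards, because d is orthogonal to b H^2. Hence d agrees almost
  everywhere with a polynomial of degree below N divided by q.\<close>

lemma model_space_continuous:
  assumes "d \<in> model_space b"
  obtains d' where "continuous_on (sphere 0 1) d'" "ae_eq_T d d'"
proof -
  define q where "q = poly (blaschke_den N \<alpha>)"
  have "q holomorphic_on UNIV"
    unfolding q_def holomorphic_on_def field_differentiable_def using poly_DERIV by blast
  then have qa: "q analytic_on cball 0 1" using analytic_on_open analytic_on_subset open_UNIV subset_UNIV by metis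
  have qn: "q z \<noteq> 0" if "cmod z = 1" for z 
    unfolding q_def using blaschke_den_nonzero[OF zeros, of z] that by simp
  define w where "w = (\<lambda>z. q z * d z)"
  have "H2_T d" using assms by (simp add: model_space_def)
  then have w: "H1_T w" unfolding w_def by (intro H1_T_analytic_mult qa H2_T_H1)
  have high: "fourier_coeff w n = 0" if n: "n \<ge> int N" for n
  proof -
    define u where "u = (\<Prod>j<N. blaschke_unit (\<alpha> j))"
    have u: "cmod u = 1" by (simp add: u_def flip: prod_norm)
    \<comment> \<open>Chosen so that b g equals z^n times the conjugate of q on the circle; the n-th
      coefficient of q d is then the pairing of b g with d.\<close>
    define g where "g = (\<lambda>z. cnj u * (z ^ nat (n - int N) * q z))"
    have "H2_T g" unfolding g_def by (intro H2_T_analytic analytic_intros qa)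
    have "fourier_coeff w n = mean_T (\<lambda>z. cnj (b z * g z) * d z)"
      unfolding fourier_coeff_mean
    proof (rule mean_T_cong)
      fix z :: complex assume z: "cmod z = 1"
      then have z0: "z \<noteq> 0" by auto
      have "b z * g z = cnj u * z ^ nat (n - int N) * (b z * q z)" by (simp add: g_def)
      also have "b z * q z = u * (z ^ N * cnj (q z))"
        unfolding b_def q_def u_def by (rule blaschke_times_den[OF zeros z])
      also have "cnj u * z ^ nat (n - int N) * (u * (z ^ N * cnj (q z))) 
          = (u * cnj u) * (z ^ (nat (n - int N) + N) * cnj (q z))" by (simp add: power_add)
      also have "u * cnj u = 1" using complex_norm_square[of u] u by simp
      also have "z ^ (nat (n - int N) + N) = z powi n"
        using n by (simp add: power_int_def nat_diff_distrib)
      finally have "cnj (b z * g z) = z powi (- n) * q z" 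
        using powi_circ_cnj[OF z, of n] by simp
      then show "w z * z powi - n = cnj (b z * g z) * d z" by (simp only: w_def) simp
    qed
    then show ?thesis using model_space_orthogonal[OF assms \<open>H2_T g\<close>] by simp
  qed
  define p where "p = (\<lambda>z. \<Sum>j<N. fourier_coeff w (int j) * z ^ j)"
  have pc: "continuous_on (sphere 0 1) p" unfolding p_def by (intro continuous_intros)
  have pf: "fourier_coeff p n = (if 0 \<le> n \<and> n < int N then fourier_coeff w n else 0)" for n
  proof -
    have "fourier_coeff (\<lambda>z. \<Sum>j<N. fourier_coeff w (int j) * z ^ j) n 
        = (\<Sum>j<N. fourier_coeff (\<lambda>z. fourier_coeff w (int j) * z ^ j) n)"
      by (intro fourier_coeff_sum L1_T_continuous continuous_intros)
    also have "\<dots> = (\<Sum>j<N. fourier_coeff w (int j) * (if n = int j then 1 else 0))"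
      using fourier_coeff_powi[of "int j" for j] by (simp add: fourier_coeff_cmult)
    also have "\<dots> = (if 0 \<le> n \<and> n < int N then fourier_coeff w n else 0)"
    proof (cases "0 \<le> n")
      case True
      then have "\<And>j. (n = int j) = (j = nat n)" by auto
      with True show ?thesis by (simp add: sum.delta' if_distrib nat_less_iff cong: if_cong)
    qed auto
    finally show ?thesis by (simp add: p_def)
  qed
  have L: "L1_T w" "L1_T p" using w by (auto simp: H1_T_def intro: L1_T_continuous pc)
  have "AE t in circM. w (cis t) - p (cis t) = 0"
  proof (rule fourier_uniqueness[of "\<lambda>z. w z - p z"])
    show "L1_T (\<lambda>z. w z - p z)" by (intro L1_T_diff L)
    show "fourier_coeff (\<lambda>z. w z - p z) n = 0" for n
      using high[of n] w by (auto simp: fourier_coeff_diff[OF L] pf H1_T_def)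
  qed
  then have "ae_eq_T d (\<lambda>z. p z / q z)"
    unfolding ae_eq_T_def
  proof eventually_elim
    case (elim t)
    then show ?case using qn[of "cis t"] by (simp add: w_def field_simps)
  qed
  moreover have "continuous_on (sphere 0 1) (\<lambda>z. p z / q z)"
    using qn by (intro continuous_intros pc analytic_circ_continuous[OF qa]) auto
  ultimately show ?thesis using that by blast
qed

text \<open>The negative-frequency part of \<open>z\<^sup>-\<^sup>n b\<^sup>k\<close>.\<close>

definition neg_part :: "nat \<Rightarrow> nat \<Rightarrow> complex \<Rightarrow> complex" where
  "neg_part n k z = (\<Sum>j<n. fourier_coeff (\<lambda>z. b z ^ k) (int j) * z powi (int j - int n))"

lemma continuous_neg_part: "continuous_on (sphere 0 1) (neg_part n k)"
  unfolding neg_part_def[abs_def] by (intro continuous_intros continuous_on_powi_circ)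

lemma fourier_coeff_neg_part:
  "fourier_coeff (neg_part n k) m = (if - int n \<le> m \<and> m < 0 then fourier_coeff (\<lambda>z. b z ^ k) (m + int n) else 0)"
proof -
  have "fourier_coeff (neg_part n k) m 
      = (\<Sum>j<n. fourier_coeff (\<lambda>z. fourier_coeff (\<lambda>z. b z ^ k) (int j) * z powi (int j - int n)) m)"
    unfolding neg_part_def[abs_def]
    by (intro fourier_coeff_sum L1_T_cmult L1_T_continuous continuous_on_powi_circ)
  also have "\<dots> = (\<Sum>j<n. if j = nat (m + int n) \<and> - int n \<le> m then fourier_coeff (\<lambda>z. b z ^ k) (m + int n) else 0)"
    by (intro sum.cong) (auto simp: fourier_coeff_cmult fourier_coeff_powi)
  also have "\<dots> = (if - int n \<le> m \<and> m < 0 then fourier_coeff (\<lambda>z. b z ^ k) (m + int n) else 0)"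
    by (cases "- int n \<le> m") (auto simp: sum.delta nat_less_iff)
  finally show ?thesis .
qed

lemma orthogonal_neg_part:
  assumes "H1_T g" shows "mean_T (\<lambda>z. cnj (g z) * neg_part n k z) = 0"
proof -
  have g: "L1_T (\<lambda>z. cnj (g z))" using assms by (simp add: H1_T_def L1_T_cnj)
  have "mean_T (\<lambda>z. cnj (g z) * neg_part n k z) = 
     mean_T (\<lambda>z. \<Sum>j<n. fourier_coeff (\<lambda>z. b z ^ k) (int j) * (cnj (g z) * z powi (int j - int n)))"
    by (simp add: neg_part_def sum_distrib_left mult_ac)
  also have "\<dots> = (\<Sum>j<n. fourier_coeff (\<lambda>z. b z ^ k) (int j) * mean_T (\<lambda>z. cnj (g z) * z powi (int j - int n)))"
    by (subst mean_T_sum) (auto intro!: L1_T_cmult L1_T_powi_mult g simp: mean_T_cmult)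
  also have "\<dots> = 0"
  proof (intro sum.neutral ballI)
    fix j assume j: "j \<in> {..<n}"
    have "mean_T (\<lambda>z. cnj (g z) * z powi (int j - int n)) = fourier_coeff (\<lambda>z. cnj (g z)) (int n - int j)"
      by (simp add: fourier_coeff_mean)
    also have "\<dots> = 0" using assms j by (simp add: fourier_coeff_cnj H1_T_def)
    finally show "fourier_coeff (\<lambda>z. b z ^ k) (int j) * mean_T (\<lambda>z. cnj (g z) * z powi (int j - int n)) = 0" by simp
  qed
  finally show ?thesis .
qed

text \<open>Let p_k be the negative part and R_k the analytic remainder of z^(-n) b^k. Then b p_k -
  p_(k+1) = R_(k+1) - b R_k is analytic. It is orthogonal to b g for g in H^2: as |b| = 1, pairing b
  g with b p_k is pairing g with p_k, and negative parts are orthogonal to analytic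
  functions.\<close>

lemma neg_part_step_model_space: 
  "(\<lambda>z. b z * neg_part n k z - neg_part n (Suc k) z) \<in> model_space b" (is "?d \<in> _")
proof -
  define R where "R = (\<lambda>k z. z powi (- int n) * b z ^ k - neg_part n k z)"
  have Rc: "continuous_on (sphere 0 1) (R k)" for k
    unfolding R_def by (intro continuous_intros continuous_b continuous_neg_part) auto
  have dc: "continuous_on (sphere 0 1) ?d"
    by (intro continuous_intros continuous_b continuous_neg_part)
  have bk: "L1_T (\<lambda>z. z powi (- int n) * b z ^ k)" for k
    by (intro L1_T_continuous continuous_intros continuous_b) auto
  have R: "H1_T (R k)" for k
  proof -
    have "fourier_coeff (R k) m = 0" if "m < 0" for m
    proof -
      have "fourier_coeff (R k) m = fourier_coeff (\<lambda>z. b z ^ k) (m + int n) - fourier_coeff (neg_part n k) m"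
        unfolding R_def by (subst fourier_coeff_diff[OF bk L1_T_continuous[OF continuous_neg_part]])
          (simp add: fourier_coeff_powi_mult)
      then show ?thesis using that 
        by (auto simp: fourier_coeff_neg_part intro: fourier_coeff_analytic_neg[OF analytic_b_power])
    qed
    then show ?thesis using L1_T_continuous[OF Rc] by (simp add: H1_T_def)
  qed
  have bR: "H1_T (\<lambda>z. b z * R k z)" by (rule H1_T_analytic_mult[OF analytic_b R])
  have eq: "?d = (\<lambda>z. R (Suc k) z - b z * R k z)"
    by (auto simp: R_def fun_eq_iff algebra_simps)
  have "fourier_coeff ?d m = 0" if "m < 0" for m
    unfolding eq using R[of "Suc k"] bR that by (simp add: fourier_coeff_diff H1_T_def)
  then have "H2_T ?d" using dc by (simp add: H2_T_def Linf_T_L2 Linf_T_continuous)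
  moreover have "inner_L2 (\<lambda>z. b z * g z) ?d = 0" if g: "H2_T g" for g
  proof -
    have bg: "H1_T (\<lambda>z. b z * g z)" by (intro H1_T_analytic_mult analytic_b H2_T_H1 g)
    have L: "L1_T (\<lambda>z. cnj (h z) * neg_part n k z)" if "H1_T h" for h k
      using L1_T_continuous_mult[OF continuous_neg_part L1_T_cnj, of h n k] that 
      by (simp add: H1_T_def mult.commute)
    have "inner_L2 (\<lambda>z. b z * g z) ?d 
        = mean_T (\<lambda>z. cnj (g z) * neg_part n k z - cnj (b z * g z) * neg_part n (Suc k) z)"
      unfolding inner_L2_mean
    proof (rule mean_T_cong)
      fix z :: complex assume "cmod z = 1"
      then have "cnj (b z * g z) * ?d z = (b z * cnj (b z)) * (cnj (g z) * neg_part n k z) - cnj (b z * g z) * neg_part n (Suc k) z"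
        by (simp add: algebra_simps)
      then show "cnj (b z * g z) * ?d z = cnj (g z) * neg_part n k z - cnj (b z * g z) * neg_part n (Suc k) z"
        using b_cnj_b[OF \<open>cmod z = 1\<close>] by simp
    qed
    also have "\<dots> = 0"
      using mean_T_diff[OF L[OF H2_T_H1[OF g]] L[OF bg]] orthogonal_neg_part[OF H2_T_H1[OF g]] orthogonal_neg_part[OF bg] by simp
    finally show ?thesis .
  qed
  ultimately show ?thesis by (simp add: model_space_def)
qed

text \<open>For fixed n the negative part has n terms, whose coefficients tend to 0 with k, so it
  tends to 0 uniformly on the circle, while b^k has modulus 1.\<close>

lemma neg_part_tendsto_0:
  assumes "L1_T F"
  shows "(\<lambda>k. mean_T (\<lambda>z. cnj (neg_part n k z) * b z ^ k * F z)) \<longlonglongrightarrow> 0"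
proof (rule Lim_null_comparison)
  let ?C = "\<lambda>k. \<Sum>j<n. cmod (fourier_coeff (\<lambda>z. b z ^ k) (int j))"
  let ?A = "cmod (mean_T (\<lambda>z. of_real (cmod (F z))))"
  show "\<forall>\<^sub>F k in sequentially. cmod (mean_T (\<lambda>z. cnj (neg_part n k z) * b z ^ k * F z)) \<le> ?C k * ?A"
  proof (intro always_eventually allI norm_mean_T_le[OF assms])
    fix k and z :: complex assume z: "cmod z = 1"
    have "cmod (neg_part n k z) \<le> ?C k"
      unfolding neg_part_def by (rule order_trans[OF norm_sum]) (simp add: norm_mult norm_power_int z)
    then show "cmod (cnj (neg_part n k z) * b z ^ k * F z) \<le> ?C k * cmod (F z)"
      by (simp add: norm_mult norm_power norm_b_circ[OF z] mult_right_mono)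
  qed (auto intro: sum_nonneg)
  have "(\<lambda>k. ?C k * ?A) \<longlonglongrightarrow> (\<Sum>j<n. cmod 0) * ?A"
    by (intro tendsto_intros fourier_coeff_b_power_tendsto_0)
  then show "(\<lambda>k. ?C k * ?A) \<longlonglongrightarrow> 0" by simp
qed

end

section \<open>Coefficients with respect to an orthonormal basis of the model space\<close>

locale blaschke_onb = blaschke_product +
  fixes v :: "nat \<Rightarrow> complex \<Rightarrow> complex"
  assumes onb': "onb_of (model_space (blaschke N \<alpha>)) N v"
begin

lemma onb: "onb_of (model_space b) N v"
  using onb' by (simp add: b_def)

lemma v_model_space: "i < N \<Longrightarrow> v i \<in> model_space b"
  using onb by (simp add: onb_of_def)

lemma v_H2: "i < N \<Longrightarrow> H2_T (v i)"
  using v_model_space by (simp add: model_space_def)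

lemma v_ortho: "i < N \<Longrightarrow> j < N \<Longrightarrow> mean_T (\<lambda>z. cnj (v i z) * v j z) = (if i = j then 1 else 0)"
  using onb by (simp add: onb_of_def inner_L2_mean)

lemma v_span: "d \<in> model_space b \<Longrightarrow> ae_eq_T d (\<lambda>z. \<Sum>i<N. inner_L2 (v i) d * v i z)"
  using onb by (simp add: onb_of_def)

lemma v_continuous: "i < N \<Longrightarrow> \<exists>w. continuous_on (sphere 0 1) w \<and> ae_eq_T (v i) w"
  using model_space_continuous[OF v_model_space] by metis

lemma v_Linf: "i < N \<Longrightarrow> Linf_T (v i)"
  using v_continuous Linf_T_continuous Linf_T_ae_eq ae_eq_T_sym by blast

lemma Linf_b_power: "Linf_T (\<lambda>z. b z ^ k)"
  by (intro Linf_T_continuous continuous_on_power continuous_b)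

lemma model_space_annihilated:
  assumes F: "Linf_T F" and orth: "\<And>i. i < N \<Longrightarrow> mean_T (\<lambda>z. cnj (v i z) * (b z ^ k * F z)) = 0"
    and d: "d \<in> model_space b"
  shows "mean_T (\<lambda>z. cnj (d z) * (b z ^ k * F z)) = 0"
proof -
  define c where "c = (\<lambda>i. inner_L2 (v i) d)"
  have bF: "Linf_T (\<lambda>z. b z ^ k * F z)" by (intro Linf_T_mult Linf_b_power F)
  have L: "L1_T (\<lambda>z. cnj (v i z) * (b z ^ k * F z))" if "i < N" for i
    by (intro Linf_T_L1 Linf_T_mult Linf_T_cnj v_Linf bF that)
  have "L2_T d" using d by (simp add: model_space_def H2_T_def)
  then have "L1_T (\<lambda>z. cnj (d z) * (b z ^ k * F z))" 
    by (rule L1_T_L2_L2[OF L2_T_cnj Linf_T_L2[OF bF]])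
  moreover have "ae_eq_T (\<lambda>z. cnj (d z) * (b z ^ k * F z)) (\<lambda>z. \<Sum>i<N. cnj (c i) * (cnj (v i z) * (b z ^ k * F z)))"
    using v_span[OF d] unfolding ae_eq_T_def
  proof eventually_elim
    case (elim t)
    show ?case unfolding elim by (simp add: c_def sum_distrib_right mult.assoc)
  qed
  ultimately have "mean_T (\<lambda>z. cnj (d z) * (b z ^ k * F z)) 
      = mean_T (\<lambda>z. \<Sum>i<N. cnj (c i) * (cnj (v i z) * (b z ^ k * F z)))"
    by (intro mean_T_ae) (auto simp: L1_T_def)
  also have "\<dots> = (\<Sum>i<N. cnj (c i) * mean_T (\<lambda>z. cnj (v i z) * (b z ^ k * F z)))"
    by (subst mean_T_sum) (auto intro: L1_T_cmult L simp: mean_T_cmult)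
  also have "\<dots> = 0" by (intro sum.neutral) (use orth in auto)
  finally show ?thesis .
qed

text \<open>
  The functions \<open>b\<^sup>-\<^sup>k d\<close> with \<open>k \<ge> 1\<close> and \<open>d\<close> in the model space span the complement of \<open>H\<^sup>2\<close>:
  with \<open>p\<^sub>k = neg_part n k\<close>, the identity \<open>b\<^sup>-\<^sup>k p\<^sub>k = b\<^sup>-\<^sup>k\<^sup>-\<^sup>1 p\<^sub>k\<^sub>+\<^sub>1 + b\<^sup>-\<^sup>k\<^sup>-\<^sup>1 (b p\<^sub>k - p\<^sub>k\<^sub>+\<^sub>1)\<close> starts at
  \<open>p\<^sub>0 = z\<^sup>-\<^sup>n\<close>, its last term is of this form, and \<open>p\<^sub>k\<close> tends to \<open>0\<close>.
\<close>

lemma orthogonal_to_shifts_imp_H1: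
  assumes F: "Linf_T F"
    and orth: "\<And>i k. i < N \<Longrightarrow> k \<ge> 1 \<Longrightarrow> mean_T (\<lambda>z. cnj (v i z) * (b z ^ k * F z)) = 0"
  shows "H1_T F"
proof -
  have "fourier_coeff F m = 0" if "m < 0" for m
  proof -
    define n where "n = nat (- m)"
    have n: "m = - int n" "n > 0" using that by (auto simp: n_def)
    let ?I = "\<lambda>k. mean_T (\<lambda>z. cnj (neg_part n k z) * b z ^ k * F z)"
    \<comment> \<open>On the circle \<open>?I k\<close> is the pairing of b^(-k) p_k with F;
      consecutive values differ by the pairing of b^(-k-1) d with F for an element d of the model
      space, which vanishes.\<close>
    have step: "?I k = ?I (Suc k)" for k
    proof -
      let ?d = "\<lambda>z. b z * neg_part n k z - neg_part n (Suc k) z"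
      have "?I k = mean_T (\<lambda>z. cnj (?d z) * (b z ^ Suc k * F z) + cnj (neg_part n (Suc k) z) * b z ^ Suc k * F z)"
      proof (rule mean_T_cong)
        fix z :: complex assume z: "cmod z = 1"
        have "cnj (?d z) * (b z ^ Suc k * F z) + cnj (neg_part n (Suc k) z) * b z ^ Suc k * F z
            = (b z * cnj (b z)) * (cnj (neg_part n k z) * b z ^ k * F z)"
          by (simp add: algebra_simps)
        then show "cnj (neg_part n k z) * b z ^ k * F z 
            = cnj (?d z) * (b z ^ Suc k * F z) + cnj (neg_part n (Suc k) z) * b z ^ Suc k * F z"
          using b_cnj_b[OF z] by simp
      qed
      also have "\<dots> = mean_T (\<lambda>z. cnj (?d z) * (b z ^ Suc k * F z)) + ?I (Suc k)"
      proof (rule mean_T_add)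
        have "continuous_on (sphere 0 1) (\<lambda>z. cnj (?d z) * b z ^ Suc k)"
          "continuous_on (sphere 0 1) (\<lambda>z. cnj (neg_part n (Suc k) z) * b z ^ Suc k)"
          by (intro continuous_intros continuous_b continuous_neg_part)+
        from L1_T_continuous_mult[OF this(1) Linf_T_L1[OF F]] L1_T_continuous_mult[OF this(2) Linf_T_L1[OF F]]
        show "L1_T (\<lambda>z. cnj (?d z) * (b z ^ Suc k * F z))" "L1_T (\<lambda>z. cnj (neg_part n (Suc k) z) * b z ^ Suc k * F z)"
          by (simp_all only: mult.assoc)
      qed
      also have "mean_T (\<lambda>z. cnj (?d z) * (b z ^ Suc k * F z)) = 0"
        by (rule model_space_annihilated[OF F orth neg_part_step_model_space]) simp_all
      finally show ?thesis by simp
    qed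
    have "?I k = ?I 0" for k by (induction k) (simp_all only: step[symmetric])
    then have "(\<lambda>k::nat. ?I 0) \<longlonglongrightarrow> 0" using neg_part_tendsto_0[OF Linf_T_L1[OF F], of n] by simp
    then have "?I 0 = 0" by (simp add: LIMSEQ_const_iff)
    moreover have "?I 0 = fourier_coeff F m"
      unfolding fourier_coeff_mean
    proof (rule mean_T_cong)
      fix z :: complex assume z: "cmod z = 1"
      have one: "fourier_coeff (\<lambda>_. 1) (int j) = (if j = 0 then 1 else 0)" for j
        using fourier_coeff_powi[of 0 "int j"] by simp
      have "neg_part n 0 z = (\<Sum>j<n. if j = 0 then z powi (- int n) else 0)"
        unfolding neg_part_def by (intro sum.cong) (auto simp: one)
      also have "\<dots> = z powi (- int n)" using n by (simp add: sum.delta)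
      finally show "cnj (neg_part n 0 z) * b z ^ 0 * F z = F z * z powi - m"
        using powi_circ_cnj[OF z, of "- int n"] by (simp add: n)
    qed
    ultimately show ?thesis by simp
  qed
  then show ?thesis by (simp add: H1_T_def Linf_T_L1[OF F])
qed

text \<open>Every G_M = b^(-M) F is analytic by the one-sided lemma, so F = b^M G_M is divisible by
  every power of b. In the n-th coefficient of this product only the first n + 1 Taylor coefficients
  of b^M occur; they tend to 0 as M grows, while those of G_M are bounded by the L^1 norm of
  F.\<close>

lemma orthogonal_to_all_shifts_imp_zero:
  assumes F: "Linf_T F"
    and orth: "\<And>i k. i < N \<Longrightarrow> mean_T (\<lambda>z. cnj (v i z) * (b z powi k * F z)) = 0"
  shows "ae_eq_T F (\<lambda>_. 0)"
proof -
  have bn: "b z \<noteq> 0" if "cmod z = 1" for z using norm_b_circ[OF that] by auto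
  define G where "G = (\<lambda>M z. b z powi (- int M) * F z)"
  have G: "Linf_T (G M)" for M
    unfolding G_def using bn by (intro Linf_T_mult F Linf_T_continuous continuous_intros continuous_b) auto
  have GH: "H1_T (G M)" for M
  proof (rule orthogonal_to_shifts_imp_H1[OF G])
    fix i k assume i: "i < N"
    have "mean_T (\<lambda>z. cnj (v i z) * (b z ^ k * G M z)) = mean_T (\<lambda>z. cnj (v i z) * (b z powi (int k - int M) * F z))"
    proof (rule mean_T_cong)
      fix z :: complex assume "cmod z = 1"
      then have "b z powi (int k + - int M) = b z powi int k * b z powi - int M"
        by (intro power_int_add disjI1 bn)
      then show "cnj (v i z) * (b z ^ k * G M z) = cnj (v i z) * (b z powi (int k - int M) * F z)"
        by (simp add: G_def)
    qed
    then show "mean_T (\<lambda>z. cnj (v i z) * (b z ^ k * G M z)) = 0" using orth[OF i] by simp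
  qed
  have FG: "F z = b z ^ M * G M z" if "cmod z = 1" for M z
    using bn[OF that] by (simp add: G_def power_int_minus)
  have L: "L1_T F" by (rule Linf_T_L1[OF F])
  let ?A = "cmod (mean_T (\<lambda>z. of_real (cmod (F z))))"
  have Gb: "cmod (fourier_coeff (G M) n) \<le> ?A" for M n
    by (rule norm_fourier_coeff_le[OF L]) (simp add: G_def norm_mult norm_power_int norm_b_circ)
  have "fourier_coeff F n = 0" for n
  proof -
    define c where "c = (\<lambda>M j. fourier_coeff (\<lambda>z. b z ^ M) (int j))"
    have bs: "boundary_series (\<lambda>z. b z ^ M) (c M)" for M
      using boundary_series_analytic[OF analytic_b_power[of M]] 
      by (simp add: c_def fourier_coeff_boundary_series[OF boundary_series_analytic[OF analytic_b_power[of M]]])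
    have le: "cmod (fourier_coeff F n) \<le> (\<Sum>j\<le>nat n. cmod (c M j)) * ?A" for M
    proof -
      have "fourier_coeff F n = fourier_coeff (\<lambda>z. b z ^ M * G M z) n"
        unfolding fourier_coeff_mean by (intro mean_T_cong) (simp only: FG[symmetric])
      moreover have "(\<lambda>j. c M j * fourier_coeff (G M) (n - int j)) sums fourier_coeff (\<lambda>z. b z ^ M * G M z) n"
        by (rule fourier_coeff_mult_sums[OF bs Linf_T_L1[OF G]])
      moreover have "(\<lambda>j. c M j * fourier_coeff (G M) (n - int j)) sums (\<Sum>j\<le>nat n. c M j * fourier_coeff (G M) (n - int j))"
      proof (rule sums_finite)
        fix j assume "j \<notin> {..nat n}"
        then have "n - int j < 0" by auto
        then show "c M j * fourier_coeff (G M) (n - int j) = 0" using GH[of M] by (simp add: H1_T_def)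
      qed simp
      ultimately have "fourier_coeff F n = (\<Sum>j\<le>nat n. c M j * fourier_coeff (G M) (n - int j))"
        using sums_unique2 by metis
      also have "cmod \<dots> \<le> (\<Sum>j\<le>nat n. cmod (c M j) * ?A)"
        by (intro sum_norm_le) (simp add: norm_mult mult_left_mono Gb)
      finally show ?thesis by (simp add: sum_distrib_right)
    qed
    have "(\<lambda>M. (\<Sum>j\<le>nat n. cmod (c M j)) * ?A) \<longlonglongrightarrow> (\<Sum>j\<le>nat n. cmod 0) * ?A"
      unfolding c_def by (intro tendsto_intros fourier_coeff_b_power_tendsto_0)
    then have "(\<lambda>M. (\<Sum>j\<le>nat n. cmod (c M j)) * ?A) \<longlonglongrightarrow> 0" by simp
    then have "cmod (fourier_coeff F n) \<le> 0"
      by (rule LIMSEQ_le_const) (use le in blast)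
    then show ?thesis by simp
  qed
  from fourier_uniqueness[OF L this] show ?thesis by (simp add: ae_eq_T_def)
qed

section \<open>The functions \<open>m i\<close> as a module basis, and the two equivalences\<close>

context
  fixes h :: "complex \<Rightarrow> complex" and m :: "nat \<Rightarrow> complex \<Rightarrow> complex"
  assumes h: "h analytic_on cball 0 1"
    and m: "\<And>i z. cmod z = 1 \<Longrightarrow> m i z = v i z * exp (- h z)"
    and J0_h: "\<And>z. cmod z = 1 \<Longrightarrow> J0 N b z = exp (h z) * cnj (exp (h z))"
begin

lemma exp_h_analytic: "(\<lambda>z. exp (h z)) analytic_on cball 0 1" "(\<lambda>z. exp (- h z)) analytic_on cball 0 1"
  by (intro analytic_intros h)+

lemma Linf_T_exp_h: "Linf_T (\<lambda>z. exp (h z))" "Linf_T (\<lambda>z. exp (- h z))"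
  by (intro Linf_T_continuous analytic_circ_continuous exp_h_analytic)+

lemma m_continuous: 
  assumes "i < N" shows "\<exists>w. continuous_on (sphere 0 1) w \<and> ae_eq_T (m i) w"
proof -
  obtain w where w: "continuous_on (sphere 0 1) w" "ae_eq_T (v i) w" using v_continuous[OF assms] by blast
  have "ae_eq_T (m i) (\<lambda>z. w z * exp (- h z))"
    using w(2) unfolding ae_eq_T_def by eventually_elim (simp add: m)
  moreover have "continuous_on (sphere 0 1) (\<lambda>z. w z * exp (- h z))"
    by (intro continuous_on_mult w analytic_circ_continuous exp_h_analytic)
  ultimately show ?thesis by blast
qed

lemma m_Linf: "i < N \<Longrightarrow> Linf_T (m i)"
  using m_continuous Linf_T_continuous Linf_T_ae_eq ae_eq_T_sym by blast

lemma Linf_T_inner_L: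
  assumes "Linf_T f" "i < N" shows "Linf_T (inner_L N b (m i) f)"
  unfolding inner_L_def by (intro Linf_T_transfer Linf_T_mult Linf_T_cnj m_Linf assms)

text \<open>The weight J_0 supplies exp(h) and its conjugate. The conjugate cancels the factor
  exp(-h) of \<open>m i\<close> under conjugation, and the analytic factor exp(h) remains with
  f.\<close>

lemma fourier_coeff_inner_L:
  assumes "Linf_T f" "i < N"
  shows "fourier_coeff (inner_L N b (m i) f) n = mean_T (\<lambda>z. cnj (v i z) * (b z powi (- n) * (exp (h z) * f z)))"
proof -
  have "fourier_coeff (inner_L N b (m i) f) n = mean_T (\<lambda>z. J0 N b z * (cnj (m i z) * f z * b z powi (- n)))"
    unfolding inner_L_def
    by (intro fourier_coeff_transfer Linf_T_L1 Linf_T_mult Linf_T_cnj m_Linf assms)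
  also have "\<dots> = mean_T (\<lambda>z. cnj (v i z) * (b z powi (- n) * (exp (h z) * f z)))"
  proof (rule mean_T_cong)
    fix z :: complex assume z: "cmod z = 1"
    have "cnj (exp (h z)) * cnj (exp (- h z)) = 1"
      by (simp flip: complex_cnj_mult exp_add)
    then show "J0 N b z * (cnj (m i z) * f z * b z powi (- n)) = cnj (v i z) * (b z powi (- n) * (exp (h z) * f z))"
      unfolding J0_h[OF z] m[OF z] complex_cnj_mult by (simp add: mult_ac)
  qed
  finally show ?thesis .
qed

lemma Hinf_T_iff:
  assumes f: "Linf_T f"
  shows "Hinf_T f \<longleftrightarrow> (\<forall>i<N. Hinf_T (inner_L N b (m i) f))"
proof
  assume H: "Hinf_T f"
  show "\<forall>i<N. Hinf_T (inner_L N b (m i) f)"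
  proof (intro allI impI)
    fix i assume i: "i < N"
    have "fourier_coeff (inner_L N b (m i) f) n = 0" if "n < 0" for n
    proof -
      \<comment> \<open>One factor b of b^(-n) is kept apart, so that the rest pairs as an element
        of b H^2 with the model space.\<close>
      define k where "k = nat (- n) - 1"
      have k: "- n = int (Suc k)" using that by (simp add: k_def)
      define g where "g = (\<lambda>z. b z ^ k * exp (h z) * f z)"
      have "(\<lambda>z. b z ^ k * exp (h z)) analytic_on cball 0 1"
        by (intro analytic_on_mult analytic_b_power exp_h_analytic)
      then have "H2_T g" unfolding g_def by (rule H2_T_analytic_mult[OF _ Hinf_T_H2[OF H]])
      have "b z powi (- n) * (exp (h z) * f z) = b z * g z" for z
        unfolding k g_def power_int_of_nat by (simp add: mult_ac)
      then show ?thesis 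
        using model_space_orthogonal'[OF v_model_space[OF i] \<open>H2_T g\<close>] 
        unfolding fourier_coeff_inner_L[OF f i] by simp
    qed
    then show "Hinf_T (inner_L N b (m i) f)" using Linf_T_inner_L[OF f i] by (simp add: Hinf_T_def)
  qed
next
  assume H: "\<forall>i<N. Hinf_T (inner_L N b (m i) f)"
  have F: "Linf_T (\<lambda>z. exp (h z) * f z)" by (intro Linf_T_mult Linf_T_exp_h f)
  have "H1_T (\<lambda>z. exp (h z) * f z)"
  proof (rule orthogonal_to_shifts_imp_H1[OF F])
    fix i k :: nat assume i: "i < N" and k: "k \<ge> 1"
    then have "fourier_coeff (inner_L N b (m i) f) (- int k) = 0" using H by (simp add: Hinf_T_def)
    then show "mean_T (\<lambda>z. cnj (v i z) * (b z ^ k * (exp (h z) * f z))) = 0"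
      unfolding fourier_coeff_inner_L[OF f i] by simp
  qed
  \<comment> \<open>The outer factor can be divided out because its reciprocal exp(-h) is analytic
    on the closed disc as well.\<close>
  from H1_T_analytic_mult[OF exp_h_analytic(2) this]
  have "H1_T (\<lambda>z. exp (- h z) * (exp (h z) * f z))" .
  moreover have "(\<lambda>z. exp (- h z) * (exp (h z) * f z)) = f"
    by (simp add: fun_eq_iff flip: mult.assoc exp_add)
  ultimately show "Hinf_T f" using f by (simp add: H1_T_def Hinf_T_def)
qed

text \<open>The coefficients reduce to pairings of v_i with b^(-n) v_j. For n < 0 these vanish since
  v_i is orthogonal to b H^2; n > 0 is the conjugate case with i and j exchanged; n = 0 is
  orthonormality.\<close>

lemma inner_L_m_m:
  assumes i: "i < N" and j: "j < N"
  shows "ae_eq_T (inner_L N b (m i) (m j)) (\<lambda>_. if i = j then 1 else 0)"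
proof -
  define \<delta> :: complex where "\<delta> = (if i = j then 1 else 0)"
  have L: "L1_T (inner_L N b (m i) (m j))" by (intro Linf_T_L1 Linf_T_inner_L m_Linf i j)
  have c: "L1_T (\<lambda>_. \<delta>)" by (intro L1_T_continuous continuous_intros)
  have fc: "fourier_coeff (\<lambda>_. \<delta>) n = (if n = 0 then \<delta> else 0)" for n
    using fourier_coeff_cmult[of \<delta> "\<lambda>z. z powi 0" n] fourier_coeff_powi[of 0 n] by simp
  have shift: "mean_T (\<lambda>z. cnj (v i z) * (b z ^ Suc k * v j z)) = 0" if "i < N" "j < N" for i j k
  proof -
    have "H2_T (\<lambda>z. b z ^ k * v j z)" by (intro H2_T_analytic_mult analytic_b_power v_H2 that)
    from model_space_orthogonal'[OF v_model_space[OF that(1)] this] show ?thesis by (simp add: mult.assoc)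
  qed
  have "fourier_coeff (inner_L N b (m i) (m j)) n = (if n = 0 then \<delta> else 0)" for n
  proof -
    have "fourier_coeff (inner_L N b (m i) (m j)) n = mean_T (\<lambda>z. cnj (v i z) * (b z powi (- n) * v j z))"
      unfolding fourier_coeff_inner_L[OF m_Linf[OF j] i]
    proof (rule mean_T_cong)
      fix z :: complex assume z: "cmod z = 1"
      have "exp (h z) * (v j z * exp (- h z)) = v j z * exp (h z + - h z)" unfolding exp_add by simp
      then have "exp (h z) * m j z = v j z" by (simp add: m[OF z])
      then show "cnj (v i z) * (b z powi (- n) * (exp (h z) * m j z)) = cnj (v i z) * (b z powi (- n) * v j z)" by simp
    qed
    also have "\<dots> = (if n = 0 then \<delta> else 0)"
    proof (cases n "0::int" rule: linorder_cases)
      case equal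
      then show ?thesis using v_ortho[OF i j] by (simp add: \<delta>_def)
    next
      case less
      define k where "k = nat (- n) - 1"
      have "b z powi (- n) = b z ^ Suc k" for z
        using less power_int_of_nat[of "b z" "Suc k"] by (simp add: k_def del: power_int_of_nat)
      then show ?thesis using shift[OF i j, of k] less by simp
    next
      case greater
      define k where "k = nat n - 1"
      have k: "n = int (Suc k)" using greater by (simp add: k_def)
      have "mean_T (\<lambda>z. cnj (v i z) * (b z powi (- n) * v j z)) = cnj (mean_T (\<lambda>z. cnj (v j z) * (b z ^ Suc k * v i z)))"
        unfolding mean_T_cnj[symmetric]
      proof (rule mean_T_cong)
        fix z :: complex assume "cmod z = 1"
        then have "cnj (b z ^ Suc k) = b z powi (- n)"
          using powi_circ_cnj[of "b z" n] norm_b_circ[of z] unfolding k power_int_of_nat by simp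
        then show "cnj (v i z) * (b z powi (- n) * v j z) = cnj (cnj (v j z) * (b z ^ Suc k * v i z))"
          by (simp only: complex_cnj_mult complex_cnj_cnj mult_ac)
      qed
      also have "\<dots> = 0" unfolding shift[OF j i] by simp
      finally show ?thesis using greater by simp
    qed
    finally show ?thesis .
  qed
  then have "fourier_coeff (\<lambda>z. inner_L N b (m i) (m j) z - \<delta>) n = 0" for n
    by (simp add: fourier_coeff_diff[OF L c] fc)
  from fourier_uniqueness[OF L1_T_diff[OF L c] this] show ?thesis
    unfolding ae_eq_T_def \<delta>_def[symmetric] by (rule eventually_mono) simp
qed

text \<open>The candidate \<open>s\<close> is the module expansion built from continuous
  representatives of the \<open>m j\<close> and of the coefficients. Orthonormality gives
  \<open>s\<close> the coefficients of f, so exp(h) (f - s) is annihilated by all b^k v_i with k an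
  integer, and f = s almost everywhere.\<close>

lemma continuous_rep_if_inner_L:
  assumes f: "Linf_T f" 
    and cont: "\<And>i. i < N \<Longrightarrow> \<exists>g. continuous_on (sphere 0 1) g \<and> ae_eq_T (inner_L N b (m i) f) g"
  shows "\<exists>g. continuous_on (sphere 0 1) g \<and> ae_eq_T f g"
proof -
  obtain g where g: "\<And>i. i < N \<Longrightarrow> continuous_on (sphere 0 1) (g i)" 
    "\<And>i. i < N \<Longrightarrow> ae_eq_T (inner_L N b (m i) f) (g i)" using cont by metis
  obtain w where w: "\<And>i. i < N \<Longrightarrow> continuous_on (sphere 0 1) (w i)" 
    "\<And>i. i < N \<Longrightarrow> ae_eq_T (m i) (w i)" using m_continuous by metis
  define s where "s = (\<lambda>z. \<Sum>j<N. w j z * g j (b z))"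
  have gb: "continuous_on (sphere 0 1) (\<lambda>z. g j (b z))" if "j < N" for j
    by (rule continuous_on_compose2[OF g(1)[OF that] continuous_b]) (auto simp: norm_b_circ)
  have s: "continuous_on (sphere 0 1) s" 
    unfolding s_def by (intro continuous_on_sum continuous_on_mult w gb) auto
  define e where "e = (\<lambda>z. f z - s z)"
  have e: "Linf_T e"
  proof -
    obtain C where "AE t in circM. cmod (f (cis t)) \<le> C" using f by (auto simp: Linf_T_def)
    moreover obtain D where "\<And>z. cmod z = 1 \<Longrightarrow> cmod (s z) \<le> D" using continuous_circ_bounded[OF s] by blast
    ultimately have "AE t in circM. cmod (e (cis t)) \<le> C + D"
    proof (elim eventually_mono)
      fix t assume "cmod (f (cis t)) \<le> C" "\<And>z. cmod z = 1 \<Longrightarrow> cmod (s z) \<le> D"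
      then have "cmod (f (cis t)) + cmod (s (cis t)) \<le> C + D" by (intro add_mono) auto
      then show "cmod (e (cis t)) \<le> C + D" unfolding e_def using norm_triangle_ineq4 order_trans by blast
    qed
    moreover have "L1_T e" unfolding e_def by (intro L1_T_diff Linf_T_L1 f Linf_T_continuous s)
    ultimately show ?thesis by (auto simp: Linf_T_def L1_T_def)
  qed
  have zero: "ae_eq_T (inner_L N b (m i) e) (\<lambda>_. 0)" if i: "i < N" for i
  proof -
    have mL: "L1_T (\<lambda>z. cnj (m i z) * m j z)" if "j < N" for j
      by (intro Linf_T_L1 Linf_T_mult Linf_T_cnj m_Linf i that)
    have wm: "AE t in circM. transfer N b (\<lambda>z. cnj (m i z) * w j z) (cis t) = (if i = j then 1 else 0)" if j: "j < N" for j
    proof -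
      have "ae_eq_T (\<lambda>z. cnj (m i z) * m j z) (\<lambda>z. cnj (m i z) * w j z)"
        using w(2)[OF j] unfolding ae_eq_T_def by eventually_elim simp
      from transfer_ae[OF mL[OF j] this] inner_L_m_m[OF i j] show ?thesis
        unfolding ae_eq_T_def inner_L_def by eventually_elim simp
    qed
    have "AE t in circM. \<forall>j\<in>{..<N}. transfer N b (\<lambda>z. cnj (m i z) * w j z) (cis t) = (if i = j then 1 else 0)"
      by (intro AE_finite_allI) (use wm in auto)
    moreover have "AE t in circM. inner_L N b (m i) f (cis t) = g i (cis t)"
      using g(2)[OF i] by (simp add: ae_eq_T_def)
    ultimately have "AE t in circM. inner_L N b (m i) e (cis t) = 0"
    proof eventually_elim
      case (elim t)
      have "inner_L N b (m i) e (cis t) = inner_L N b (m i) f (cis t) - transfer N b (\<lambda>z. cnj (m i z) * s z) (cis t)"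
        unfolding inner_L_def e_def right_diff_distrib by (rule transfer_diff)
      \<comment> \<open>Exchanging the fibre sum with the basis sum isolates each g_j(b z), which
        the module identity then takes out of the transfer.\<close>
      also have "transfer N b (\<lambda>z. cnj (m i z) * s z) (cis t) 
          = (\<Sum>j<N. transfer N b (\<lambda>z. (cnj (m i z) * w j z) * g j (b z)) (cis t))"
        unfolding transfer_def sum_divide_distrib[symmetric]
        by (subst sum.swap) (simp add: s_def sum_distrib_left mult.assoc)
      also have "\<dots> = (\<Sum>j<N. transfer N b (\<lambda>z. cnj (m i z) * w j z) (cis t) * g j (cis t))"
        by (intro sum.cong refl transfer_mult_b) simp
      also have "\<dots> = (\<Sum>j<N. (if i = j then g j (cis t) else 0))"
        by (intro sum.cong) (use elim(1) in auto)
      also have "\<dots> = g i (cis t)" using i by simp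
      finally show ?case using elim(2) by simp
    qed
    then show ?thesis by (simp add: ae_eq_T_def)
  qed
  have "ae_eq_T (\<lambda>z. exp (h z) * e z) (\<lambda>_. 0)"
  proof (rule orthogonal_to_all_shifts_imp_zero)
    show "Linf_T (\<lambda>z. exp (h z) * e z)" by (intro Linf_T_mult Linf_T_exp_h e)
    fix i k assume i: "i < N"
    have "fourier_coeff (inner_L N b (m i) e) (- k) = fourier_coeff (\<lambda>_. 0) (- k)"
      unfolding fourier_coeff_mean
    proof (rule mean_T_ae)
      show "ae_eq_T (\<lambda>z. inner_L N b (m i) e z * z powi - (- k)) (\<lambda>z. 0 * z powi - (- k))"
        using zero[OF i] unfolding ae_eq_T_def by eventually_elim simp
      have "L1_T (\<lambda>z. inner_L N b (m i) e z * z powi - (- k))"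
        by (intro L1_T_powi_mult Linf_T_L1 Linf_T_inner_L e i)
      then show "on_circ (\<lambda>z. inner_L N b (m i) e z * z powi - (- k)) \<in> borel_measurable circM"
        by (auto simp: L1_T_def)
    qed
    also have "\<dots> = 0" by (simp add: fourier_coeff_def)
    finally show "mean_T (\<lambda>z. cnj (v i z) * (b z powi k * (exp (h z) * e z))) = 0"
      unfolding fourier_coeff_inner_L[OF e i] by simp
  qed
  then have "ae_eq_T f s" unfolding ae_eq_T_def by eventually_elim (simp add: e_def)
  then show ?thesis using s by blast
qed

lemma disc_alg_T_iff:
  assumes f: "Linf_T f"
  shows "disc_alg_T f \<longleftrightarrow> (\<forall>i<N. disc_alg_T (inner_L N b (m i) f))"
proof
  assume D: "disc_alg_T f"
  then obtain g where g: "continuous_on (sphere 0 1) g" "ae_eq_T f g" by (auto simp: disc_alg_T_def)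
  show "\<forall>i<N. disc_alg_T (inner_L N b (m i) f)"
  proof (intro allI impI)
    fix i assume i: "i < N"
    obtain w where w: "continuous_on (sphere 0 1) w" "ae_eq_T (m i) w" using m_continuous[OF i] by blast
    have "ae_eq_T (\<lambda>z. cnj (m i z) * f z) (\<lambda>z. cnj (w z) * g z)"
      using w(2) g(2) unfolding ae_eq_T_def by eventually_elim simp
    moreover have "L1_T (\<lambda>z. cnj (m i z) * f z)" by (intro Linf_T_L1 Linf_T_mult Linf_T_cnj m_Linf i f)
    ultimately have "ae_eq_T (inner_L N b (m i) f) (transfer N b (\<lambda>z. cnj (w z) * g z))"
      unfolding inner_L_def by (intro transfer_ae)
    moreover have "continuous_on (sphere 0 1) (transfer N b (\<lambda>z. cnj (w z) * g z))"
      by (intro continuous_transfer continuous_intros w g)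
    ultimately show "disc_alg_T (inner_L N b (m i) f)"
      using D Hinf_T_iff[OF f] i by (auto simp: disc_alg_T_def)
  qed
next
  assume "\<forall>i<N. disc_alg_T (inner_L N b (m i) f)"
  then show "disc_alg_T f"
    using Hinf_T_iff[OF f] continuous_rep_if_inner_L[OF f] by (simp add: disc_alg_T_def)
qed

end

end

theorem theorem5p4:
  fixes N :: nat and \<alpha> :: "nat \<Rightarrow> complex"
    and v :: "nat \<Rightarrow> complex \<Rightarrow> complex" and f :: "complex \<Rightarrow> complex"
  assumes "N \<ge> 1"
    and "\<forall>j<N. \<alpha> j \<in> ball 0 1"
    and "onb_of (model_space (blaschke N \<alpha>)) N v"
    and "Linf_T f"
  defines "m \<equiv> (\<lambda>i z. v i z * J_inv_sqrt N (blaschke N \<alpha>) z)"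
  shows "(Hinf_T f \<longleftrightarrow> (\<forall>i<N. Hinf_T (inner_L N (blaschke N \<alpha>) (m i) f)))
       \<and> (disc_alg_T f \<longleftrightarrow> (\<forall>i<N. disc_alg_T (inner_L N (blaschke N \<alpha>) (m i) f)))"
proof -
  interpret blaschke_onb N \<alpha> v by unfold_locales (use assms in auto)
  obtain h where h: "h analytic_on cball 0 1"
    "\<And>z. cmod z = 1 \<Longrightarrow> J_inv_sqrt N (blaschke N \<alpha>) z = exp (- h z)"
    "\<And>z. cmod z = 1 \<Longrightarrow> J0 N (blaschke N \<alpha>) z = exp (h z) * cnj (exp (h z))"
    using J_inv_sqrt_exp[OF assms(1,2)] by blast
  have m: "m i z = v i z * exp (- h z)" if "cmod z = 1" for i z
    by (simp add: m_def h(2)[OF that])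
  show ?thesis
    using Hinf_T_iff[OF h(1) m h(3)[folded b_def] assms(4)] disc_alg_T_iff[OF h(1) m h(3)[folded b_def] assms(4)]
    by (simp only: b_def)
qed

end
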